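(* Let $k$ be a field of characteristic $0$, $n\ge1$, $G=\mathrm{GL}_{n/k}$. Let $w,w'\in\mathcal S_n$ with $w'\preceq w$. Assume that there exist integers $a<b$ in $\{1,\dots,n\}$ and $q_0\in\{1,\dots,n-2\}$ such that: (i) $a\notin\{w(1),\dots,w(q_0+1)\}$ and $a\in\{w'(1),\dots,w'(q_0+1)\}$; (ii) $b\in\{w(1),\dots,w(q_0+1)\}$ and $b\notin\{w'(1),\dots,w'(q_0+1)\}$; (iii) for any $i\in\{w'(1),\dots,w'(q_0+1)\}$ such that $i\neq a$ and $i<b$, we have $i\in\{w(1),\dots,w(q_0+1)\}$; (iv) $a$ and $b$ are not in the same orbit under $ww'^{-1}$. Then $$\widetilde V_{w'}\cap q^{-1}(\mathfrak t^{ww'^{-1}}+\mathfrak u)\not\subseteq\widetilde X_w.$$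
   Context: $B$, $T$, $U$ are the subgroups of $G$ of upper triangular, diagonal and unipotent upper triangular matrices, with Lie algebras $\mathfrak b,\mathfrak t,\mathfrak u$. The Weyl group is $\mathcal S_n$ (permutation matrices, $we_i=e_{w(i)}$) with Bruhat order $\preceq$; $\mathfrak t^{v}$ is the subspace of $\mathfrak t$ fixed by $\mathrm{Ad}(v)$. Identify $\widetilde X=\{(gB,\psi)\in G/B\times\mathfrak b:\mathrm{Ad}(g^{-1})\psi\in\mathfrak b\}$ (reduced), $q\colon\widetilde X\to\mathfrak b$ the second projection, $\widetilde V_w=\{(gB,\psi)\in\widetilde X: gB\in BwB/B\}$, and $\widetilde X_w$ the Zariski closure of $\widetilde V_w$ in $\widetilde X$. *)

theory Defs
  imports
    "HOL-Analysis.Abstract_Topology"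
    "HOL-Algebra.Coset"
    "HOL-Algebra.Algebraic_Closure_Type"
    "HOL-Combinatorics.Orbits"
    "HOL-Combinatorics.Transposition"
    "Jordan_Normal_Form.Matrix"
begin

text \<open>
  A \<open>k\<close>-variety is represented by its points over the algebraic closure of \<open>k\<close>, with the Zariski
  topology over \<open>k\<close> (closed sets are cut out by equations with coefficients in \<open>k\<close>). Inclusions
  between constructible subsets of a \<open>k\<close>-scheme of finite type are detected on these points. Matrix entries
  are indexed from 0 and the Weyl group acts on \<open>{1..n}\<close>, so the basis vector \<open>e\<^sub>i\<close> has
  position \<open>i - 1\<close>.
\<close>

definition GL :: "nat \<Rightarrow> 'a::field mat monoid" where
  "GL n = units_of (ring_mat TYPE('a) n ())"

definition borel_subgroup :: "nat \<Rightarrow> 'a::field mat set" where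
  "borel_subgroup n = {g \<in> carrier (GL n). upper_triangular g}"

definition lie_b :: "nat \<Rightarrow> 'a::field mat set" where
  "lie_b n = {A \<in> carrier_mat n n. upper_triangular A}"

definition lie_t :: "nat \<Rightarrow> 'a::field mat set" where
  "lie_t n = {A \<in> carrier_mat n n. diagonal_mat A}"

definition lie_u :: "nat \<Rightarrow> 'a::field mat set" where
  "lie_u n = {A \<in> carrier_mat n n. \<forall>i<n. \<forall>j\<le>i. A $$ (i, j) = 0}"

definition Ad :: "nat \<Rightarrow> 'a::field mat \<Rightarrow> 'a mat \<Rightarrow> 'a mat" where
  "Ad n g A = g * A * inv\<^bsub>GL n\<^esub> g"

definition perm_mat :: "nat \<Rightarrow> (nat \<Rightarrow> nat) \<Rightarrow> 'a::field mat" where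
  "perm_mat n w = mat n n (\<lambda>(i, j). if Suc i = w (Suc j) then 1 else 0)"

definition lie_t_fixed :: "nat \<Rightarrow> (nat \<Rightarrow> nat) \<Rightarrow> 'a::field mat set" where
  "lie_t_fixed n v = {A \<in> lie_t n. Ad n (perm_mat n v) A = A}"

text \<open>The number of inversions is the Coxeter length on the symmetric group, and the Bruhat order
  is generated by length-increasing multiplication by reflections.\<close>

definition inversions :: "nat \<Rightarrow> (nat \<Rightarrow> nat) \<Rightarrow> nat" where
  "inversions n w = card {(i, j). 1 \<le> i \<and> i < j \<and> j \<le> n \<and> w j < w i}"

definition bruhat_step :: "nat \<Rightarrow> (nat \<Rightarrow> nat) \<Rightarrow> (nat \<Rightarrow> nat) \<Rightarrow> bool" where
  "bruhat_step n u v \<longleftrightarrow>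
     (\<exists>i j. 1 \<le> i \<and> i < j \<and> j \<le> n \<and> v = u \<circ> transpose i j \<and> inversions n u < inversions n v)"

definition bruhat_le :: "nat \<Rightarrow> (nat \<Rightarrow> nat) \<Rightarrow> (nat \<Rightarrow> nat) \<Rightarrow> bool" where
  "bruhat_le n = (bruhat_step n)\<^sup>*\<^sup>*"

definition flag_coset :: "nat \<Rightarrow> 'a::field mat \<Rightarrow> 'a mat set" where
  "flag_coset n g = g <#\<^bsub>GL n\<^esub> borel_subgroup n"

definition flag_variety :: "nat \<Rightarrow> 'a::field mat set set" where
  "flag_variety n = flag_coset n ` carrier (GL n)"

definition schubert_cell :: "nat \<Rightarrow> (nat \<Rightarrow> nat) \<Rightarrow> 'a::field mat set set" where
  "schubert_cell n w = {flag_coset n (b * perm_mat n w) | b. b \<in> borel_subgroup n}"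

text \<open>Polynomial functions over \<open>k\<close> in the entries of a pair of matrices. On \<open>GL\<^sub>n \<times> \<bb>\<close>
  the inverse of the determinant gives no further basic open sets, since it is a unit.\<close>

inductive_set poly_functions ::
    "nat \<Rightarrow> ('k::field alg_closure mat \<times> 'k alg_closure mat \<Rightarrow> 'k alg_closure) set"
  for n :: nat where
  const: "(\<lambda>_. to_ac c) \<in> poly_functions n"
| entry_fst: "i < n \<Longrightarrow> j < n \<Longrightarrow> (\<lambda>(g, \<psi>). g $$ (i, j)) \<in> poly_functions n"
| entry_snd: "i < n \<Longrightarrow> j < n \<Longrightarrow> (\<lambda>(g, \<psi>). \<psi> $$ (i, j)) \<in> poly_functions n"
| add: "f \<in> poly_functions n \<Longrightarrow> h \<in> poly_functions n \<Longrightarrow> (\<lambda>x. f x + h x) \<in> poly_functions n"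
| mult: "f \<in> poly_functions n \<Longrightarrow> h \<in> poly_functions n \<Longrightarrow> (\<lambda>x. f x * h x) \<in> poly_functions n"

definition zariski_group :: "nat \<Rightarrow> ('k::field alg_closure mat \<times> 'k alg_closure mat) topology" where
  "zariski_group n = topology_generated_by
     ((\<lambda>f. {x \<in> carrier (GL n) \<times> lie_b n. f x \<noteq> 0}) ` poly_functions n)"

text \<open>The Zariski topology on \<open>G/B \<times> \<bb>\<close> is the quotient topology from \<open>G \<times> \<bb>\<close>, as
  \<open>G \<rightarrow> G/B\<close> is flat and surjective.\<close>

definition zariski_flag :: "nat \<Rightarrow> ('k::field alg_closure mat set \<times> 'k alg_closure mat) topology" where
  "zariski_flag n = topology (\<lambda>S. S \<subseteq> flag_variety n \<times> lie_b n \<and>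
     openin (zariski_group n)
       {(g, \<psi>) \<in> carrier (GL n) \<times> lie_b n. (flag_coset n g, \<psi>) \<in> S})"

definition X_tilde :: "nat \<Rightarrow> ('a::field mat set \<times> 'a mat) set" where
  "X_tilde n = {(flag_coset n g, \<psi>) | g \<psi>.
     g \<in> carrier (GL n) \<and> \<psi> \<in> lie_b n \<and> Ad n (inv\<^bsub>GL n\<^esub> g) \<psi> \<in> lie_b n}"

definition V_tilde :: "nat \<Rightarrow> (nat \<Rightarrow> nat) \<Rightarrow> ('a::field mat set \<times> 'a mat) set" where
  "V_tilde n w = {(F, \<psi>) \<in> X_tilde n. F \<in> schubert_cell n w}"

definition q_preimage :: "nat \<Rightarrow> 'a::field mat set \<Rightarrow> ('a mat set \<times> 'a mat) set" where
  "q_preimage n S = {x \<in> X_tilde n. snd x \<in> S}"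

definition X_tilde_w ::
    "nat \<Rightarrow> (nat \<Rightarrow> nat) \<Rightarrow> ('k::field alg_closure mat set \<times> 'k alg_closure mat) set" where
  "X_tilde_w n w =
     Abstract_Topology.closure_of (subtopology (zariski_flag n) (X_tilde n)) (V_tilde n w)"

lemma topspace_zariski_group: "topspace (zariski_group n) = carrier (GL n) \<times> lie_b n"
proof -
  have "(\<lambda>_. to_ac 1) \<in> poly_functions n" by (rule poly_functions.const)
  then show ?thesis unfolding zariski_group_def by (auto intro!: bexI[of _ "\<lambda>_. to_ac 1"])
qed

lemma istopology_zariski_flag:
  "istopology (\<lambda>S. S \<subseteq> flag_variety n \<times> lie_b n \<and>
     openin (zariski_group n)
       {(g, \<psi>) \<in> carrier (GL n) \<times> lie_b n. (flag_coset n g, \<psi>) \<in> S})"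
    (is "istopology (\<lambda>S. S \<subseteq> ?Y \<and> openin _ (?P S))")
proof -
  have *: "?P (S \<inter> T) = ?P S \<inter> ?P T" for S T by blast
  have **: "?P (\<Union>\<K>) = \<Union>(?P ` \<K>)" for \<K> by blast
  have "S \<inter> T \<subseteq> ?Y \<and> openin (zariski_group n) (?P (S \<inter> T))"
    if "S \<subseteq> ?Y \<and> openin (zariski_group n) (?P S)" "T \<subseteq> ?Y \<and> openin (zariski_group n) (?P T)" for S T
    unfolding * using openin_Int[OF conjunct2[OF that(1)] conjunct2[OF that(2)]] that(1) by blast
  moreover have "\<Union>\<K> \<subseteq> ?Y \<and> openin (zariski_group n) (?P (\<Union>\<K>))"
    if "\<forall>S\<in>\<K>. S \<subseteq> ?Y \<and> openin (zariski_group n) (?P S)" for \<K>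
  proof
    show "\<Union>\<K> \<subseteq> ?Y" using that by blast
    show "openin (zariski_group n) (?P (\<Union>\<K>))"
      unfolding ** by (rule openin_Union) (use that in blast)
  qed
  ultimately show ?thesis
    unfolding istopology_def by meson
qed

lemma quotient_map_zariski_flag:
  "quotient_map (zariski_group n :: ('k::field alg_closure mat \<times> 'k alg_closure mat) topology)
     (zariski_flag n) (\<lambda>(g, \<psi>). (flag_coset n g, \<psi>))"
proof -
  let ?X = "zariski_group n :: ('k alg_closure mat \<times> 'k alg_closure mat) topology"
  let ?Z = "zariski_flag n :: ('k alg_closure mat set \<times> 'k alg_closure mat) topology"
  let ?Y = "flag_variety n \<times> lie_b n :: ('k alg_closure mat set \<times> 'k alg_closure mat) set"
  let ?P = "\<lambda>S. {(g, \<psi>) \<in> carrier (GL n) \<times> lie_b n. (flag_coset n g, \<psi>) \<in> S}"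
  have op: "openin ?Z S \<longleftrightarrow> S \<subseteq> ?Y \<and> openin ?X (?P S)" for S
    unfolding zariski_flag_def topology_inverse'[OF istopology_zariski_flag] ..
  have "?P ?Y = topspace ?X"
    unfolding topspace_zariski_group flag_variety_def by blast
  then have "openin ?X (?P ?Y)"
    using openin_topspace[of ?X] by (simp only:)
  then have "openin ?Z ?Y"
    unfolding op by blast
  then have top: "topspace ?Z = ?Y"
    by (intro subset_antisym openin_subset) (use op[of "topspace ?Z"] in simp_all)
  have eq: "{x. x \<in> carrier (GL n) \<times> lie_b n \<and> (case x of (g, \<psi>) \<Rightarrow> (flag_coset n g, \<psi>)) \<in> S} = ?P S" for S
    by auto
  have img: "(\<lambda>(g, \<psi>). (flag_coset n g, \<psi>)) ` (carrier (GL n) \<times> lie_b n) = ?Y"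
    by (auto simp: flag_variety_def image_iff)
  show ?thesis
    unfolding quotient_map_def top topspace_zariski_group eq op using img by simp
qed

end

theory Submission
  imports Defs "Jordan_Normal_Form.Determinant"
begin

text \<open>
  Let \<open>p = q\<^sub>0 + 1\<close>, let \<open>F\<^sub>p\<close> be the \<open>p\<close>-dimensional member of the flag \<open>gB\<close> and \<open>E\<^sub>b\<close> the span of
  \<open>e\<^sub>1, \<dots>, e\<^sub>b\<close>. On \<open>BwB/B\<close> the endomorphism \<open>\<psi>\<close> acts on \<open>E\<^sub>b / (E\<^sub>b \<inter> F\<^sub>p)\<close> with
  eigenvalues \<open>\<psi>\<^sub>i\<^sub>i\<close> for \<open>i \<le> b\<close> outside \<open>w{1..p}\<close>. By the Bruhat relation and (i)-(iii), this index set
  is \<open>insert a S\<close>, and that of \<open>w'\<close> is \<open>insert b S\<close> for the same \<open>S\<close>; so the quotient has the same dimension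
  on both cells, and its determinant is a quotient of two minors, regular near the cell of \<open>w'\<close>. Hence
  a polynomial equation holds on \<open>X\<^sub>w\<close> which, at the point of \<open>V\<^sub>w\<^sub>'\<close> given by \<open>w'\<close> and a diagonal
  \<open>\<psi>\<close>, forces \<open>\<psi>\<^sub>a\<^sub>a = \<psi>\<^sub>b\<^sub>b\<close> as soon as \<open>\<psi>\<close> is invertible. By (iv) the diagonal entries can be taken
  constant on the orbits of \<open>ww'\<^sup>-\<^sup>1\<close> with different values at \<open>a\<close> and \<open>b\<close>.
\<close>

section \<open>Bruhat order and the rank inequality for prefixes\<close>

text \<open>The map \<open>h\<close> injects the inversions of
  \<open>u \<circ> transpose i j\<close> into those of \<open>u\<close>. It moves both positions by
  the transposition, except when that would reverse their order; such a pair stays in place and is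
  an inversion of \<open>u\<close> because \<open>u j \<le> u i\<close>. Its contrapositive shows
  that a Bruhat step has \<open>u i < u j\<close>.\<close>

lemma inversions_transpose_le:
  assumes ij: "1 \<le> i" "i < j" "j \<le> n" and u: "u j \<le> u i"
  shows "inversions n (u \<circ> transpose i j) \<le> inversions n u"
proof -
  let ?t = "transpose i j"
  let ?P = "\<lambda>v. {(x, y). 1 \<le> x \<and> x < y \<and> y \<le> n \<and> (v :: nat \<Rightarrow> nat) y < v x}"
  define h where "h = (\<lambda>(x, y). if ?t x < ?t y then (?t x, ?t y) else (x, y))"
  have fin: "finite (?P u)"
    by (rule finite_subset[of _ "{1..n} \<times> {1..n}"]) auto
  have t: "1 \<le> ?t x \<and> ?t x \<le> n" if "1 \<le> x" "x \<le> n" for x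
    using that ij by (auto simp: transpose_def)
  have "h z \<in> ?P u" if z: "z \<in> ?P (u \<circ> ?t)" for z
  proof -
    obtain x y where xy: "z = (x, y)" "1 \<le> x" "x < y" "y \<le> n" "u (?t y) < u (?t x)"
      using z by auto
    show ?thesis
    proof (cases "?t x < ?t y")
      case True
      then show ?thesis using xy t[of x] t[of y] by (auto simp: h_def)
    next
      case False
      then have "u y < u x"
        using xy ij u by (auto simp: transpose_def split: if_splits)
      then show ?thesis using False xy by (auto simp: h_def)
    qed
  qed
  moreover have "inj_on h (?P (u \<circ> ?t))"
  proof (rule inj_onI, clarify)
    fix x y x' y'
    assume "x < y" "x' < y'" and eq: "h (x, y) = h (x', y')"
    then show "x = x' \<and> y = y'"
      unfolding h_def by (auto simp: transpose_eq_iff split: if_splits)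
  qed
  ultimately have "card (?P (u \<circ> ?t)) \<le> card (?P u)"
    using card_inj_on_le[OF _ image_subsetI fin] by blast
  then show ?thesis unfolding inversions_def by simp
qed

text \<open>A step exchanges \<open>u i < u j\<close>. A prefix containing both positions keeps its
  set of values; a prefix ending before \<open>j\<close> can at most have \<open>u i\<close>
  replaced by the larger \<open>u j\<close>. Iterated, this gives the easy half of the rank
  criterion for the Bruhat order.\<close>

lemma bruhat_step_card_le:
  assumes "bruhat_step n u v"
  shows "card {x \<in> {1..p}. v x \<le> b} \<le> card {x \<in> {1..p}. u x \<le> b}"
proof -
  obtain i j where ij: "1 \<le> i" "i < j" "j \<le> n" and v: "v = u \<circ> transpose i j"
    and "inversions n u < inversions n v"
    using assms unfolding bruhat_step_def by blast
  then have u: "u i < u j"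
    using inversions_transpose_le[of i j n u] by fastforce
  show ?thesis
  proof (cases "j \<le> p")
    case True
    have "{x \<in> {1..p}. v x \<le> b} \<subseteq> transpose i j ` {x \<in> {1..p}. u x \<le> b}"
    proof
      fix x assume x: "x \<in> {x \<in> {1..p}. v x \<le> b}"
      then have "transpose i j x \<in> {x \<in> {1..p}. u x \<le> b}"
        using ij True by (auto simp: v transpose_def)
      then show "x \<in> transpose i j ` {x \<in> {1..p}. u x \<le> b}"
        by (metis imageI transpose_involutory)
    qed
    then have "card {x \<in> {1..p}. v x \<le> b} \<le> card (transpose i j ` {x \<in> {1..p}. u x \<le> b})"
      by (intro card_mono) auto
    also have "\<dots> \<le> card {x \<in> {1..p}. u x \<le> b}"
      by (intro card_image_le) auto
    finally show ?thesis .
  next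
    case False
    then show ?thesis
      using u by (intro card_mono) (auto simp: v transpose_def split: if_splits)
  qed
qed

lemma bruhat_le_card_le:
  assumes "bruhat_le n u v"
  shows "card {x \<in> {1..p}. v x \<le> b} \<le> card {x \<in> {1..p}. u x \<le> b}"
  using assms unfolding bruhat_le_def
  by (induction rule: rtranclp_induct) (use bruhat_step_card_le le_trans in \<open>blast+\<close>)

section \<open>Block triangular determinants and upper triangular matrices\<close>

text \<open>A term of the Leibniz formula vanishes if its permutation sends some row outside
  \<open>R\<close> to a column in \<open>C\<close>. By cardinality every other permutation maps
  \<open>R\<close> onto \<open>C\<close>, so the entries in rows \<open>R\<close> and columns
  outside \<open>C\<close>, the only ones where \<open>A\<close> and \<open>B\<close> may differ,
  never occur.\<close>

lemma det_eq_off_block: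
  fixes A B :: "'a::comm_ring_1 mat"
  assumes A: "A \<in> carrier_mat n n" and B: "B \<in> carrier_mat n n"
    and R: "R \<subseteq> {..<n}" and C: "C \<subseteq> {..<n}" and card: "card R = card C"
    and zA: "\<And>i j. i < n \<Longrightarrow> i \<notin> R \<Longrightarrow> j \<in> C \<Longrightarrow> A $$ (i, j) = 0"
    and eq: "\<And>i j. i < n \<Longrightarrow> j < n \<Longrightarrow> i \<notin> R \<or> j \<in> C \<Longrightarrow> A $$ (i, j) = B $$ (i, j)"
  shows "det A = det B"
  unfolding det_def'[OF A] det_def'[OF B]
proof (rule sum.cong[OF refl])
  fix p assume "p \<in> {p. p permutes {0..<n}}"
  then have p: "p permutes {0..<n}" by simp
  have "(\<Prod>i = 0..<n. A $$ (i, p i)) = (\<Prod>i = 0..<n. B $$ (i, p i))"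
  proof (cases "\<exists>i<n. i \<notin> R \<and> p i \<in> C")
    case True
    then obtain i where i: "i < n" "i \<notin> R" "p i \<in> C" by blast
    then have "A $$ (i, p i) = 0" "B $$ (i, p i) = 0"
      using zA eq[of i "p i"] C by auto
    moreover have "i \<in> {0..<n}" using i by simp
    ultimately have "(\<Prod>i = 0..<n. A $$ (i, p i)) = 0" "(\<Prod>i = 0..<n. B $$ (i, p i)) = 0"
      by (blast intro: prod_zero[OF finite_atLeastLessThan])+
    then show ?thesis by simp
  next
    case False
    have sub: "inv_into UNIV p ` C \<subseteq> R"
    proof
      fix x assume "x \<in> inv_into UNIV p ` C"
      then obtain c where c: "c \<in> C" "x = inv_into UNIV p c" by blast
      then have px: "p x = c" using permutes_inverses(1)[OF p] by simp
      then have "x < n" using c C permutes_in_image[OF p, of x] by auto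
      with False c px show "x \<in> R" by auto
    qed
    have "finite R" using R by (rule finite_subset) simp
    moreover have "card (inv_into UNIV p ` C) = card C"
      by (rule card_image[OF permutes_inj_on[OF permutes_inv[OF p]]])
    ultimately have img: "inv_into UNIV p ` C = R"
      using card card_subset_eq[OF _ sub] by simp
    have "p i \<in> C" if "i \<in> R" for i
    proof -
      obtain c where "c \<in> C" "i = inv_into UNIV p c" using \<open>i \<in> R\<close> unfolding img[symmetric] by blast
      then show ?thesis using permutes_inverses(1)[OF p] by simp
    qed
    moreover have "p i < n" if "i < n" for i
      using permutes_in_image[OF p, of i] that by simp
    ultimately have "A $$ (i, p i) = B $$ (i, p i)" if "i < n" for i
      using that eq[of i "p i"] by blast
    then show ?thesis by simp
  qed
  then show "signof p * (\<Prod>i = 0..<n. A $$ (i, p i)) = signof p * (\<Prod>i = 0..<n. B $$ (i, p i))"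
    by simp
qed

text \<open>Working up from the last row, the entry \<open>(i, j)\<close> of \<open>A * Y\<close>
  with \<open>j < i\<close> reduces to \<open>A $$ (i, i) * Y $$ (i, j)\<close>, and the diagonal of
  \<open>A\<close> has no zero because \<open>det A\<close> is a unit.\<close>

lemma upper_triangular_right_inverse:
  fixes A Y :: "'a::field mat"
  assumes A: "A \<in> carrier_mat n n" "upper_triangular A" and Y: "Y \<in> carrier_mat n n"
    and AY: "A * Y = 1\<^sub>m n"
  shows "upper_triangular Y"
proof -
  have "det A * det Y = 1"
    using det_mult[OF A(1) Y] AY by simp
  then have "det A \<noteq> 0" by auto
  then have diag: "A $$ (i, i) \<noteq> 0" if "i < n" for i
    using upper_triangular_imp_det_eq_0_iff[OF A] that A(1) by (force simp: diag_mat_def)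
  have "\<forall>j<i. Y $$ (i, j) = 0" if "i < n" for i
    using that
  proof (induction "n - i" arbitrary: i rule: less_induct)
    case less
    show ?case
    proof (intro allI impI)
      fix j assume j: "j < i"
      have "0 = (A * Y) $$ (i, j)"
        unfolding AY using j less.prems by simp
      also have "\<dots> = (\<Sum>k = 0..<n. A $$ (i, k) * Y $$ (k, j))"
        using A Y j less.prems by (simp add: scalar_prod_def)
      also have "\<dots> = (\<Sum>k = 0..<n. if k = i then A $$ (i, i) * Y $$ (i, j) else 0)"
      proof (rule sum.cong[OF refl])
        fix k assume k: "k \<in> {0..<n}"
        consider "k < i" | "k = i" | "i < k" by linarith
        then show "A $$ (i, k) * Y $$ (k, j) = (if k = i then A $$ (i, i) * Y $$ (i, j) else 0)"
        proof cases
          case 1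
          then show ?thesis using A less.prems by auto
        next
          case 3
          then have "Y $$ (k, j) = 0" using less k j by auto
          then show ?thesis using 3 by simp
        qed simp
      qed
      also have "\<dots> = A $$ (i, i) * Y $$ (i, j)"
        using less.prems by simp
      finally show "Y $$ (i, j) = 0" using diag[OF less.prems] by simp
    qed
  qed
  then show ?thesis using Y by auto
qed

lemma upper_triangular_mult:
  fixes A B :: "'a::semiring_0 mat"
  assumes A: "A \<in> carrier_mat n n" "upper_triangular A"
    and B: "B \<in> carrier_mat n n" "upper_triangular B"
  shows "upper_triangular (A * B)"
    and "i < n \<Longrightarrow> (A * B) $$ (i, i) = A $$ (i, i) * B $$ (i, i)"
proof -
  have entry: "(A * B) $$ (i, j) = (if i = j then A $$ (i, i) * B $$ (i, i) else 0)"
    if "i < n" "j \<le> i" for i j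
  proof -
    have "(A * B) $$ (i, j) = (\<Sum>k = 0..<n. A $$ (i, k) * B $$ (k, j))"
      using A B that by (simp add: scalar_prod_def)
    also have "\<dots> = (\<Sum>k = 0..<n. if k = i then if i = j then A $$ (i, i) * B $$ (i, i) else 0 else 0)"
    proof (rule sum.cong[OF refl])
      fix k assume k: "k \<in> {0..<n}"
      consider "k < i" | "i < k" | "k = i" "j < i" | "k = i" "i = j"
        using \<open>j \<le> i\<close> by linarith
      then show "A $$ (i, k) * B $$ (k, j)
          = (if k = i then if i = j then A $$ (i, i) * B $$ (i, i) else 0 else 0)"
        using upper_triangularD[OF A(2), of k i] upper_triangularD[OF B(2), of j k] A(1) B(1) that k
        by cases auto
    qed
    finally show ?thesis using that by simp
  qed
  show "upper_triangular (A * B)"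
    by (rule upper_triangularI) (use A in \<open>simp add: entry\<close>)
  show "(A * B) $$ (i, i) = A $$ (i, i) * B $$ (i, i)" if "i < n"
    using that by (simp add: entry)
qed

section \<open>The two minors and the determinant on the quotient\<close>

text \<open>
  For \<open>J = w'{1..p}\<close> and \<open>\<tau> = w'\<^sup>-\<^sup>1\<close> the columns in \<open>J\<close> span \<open>F\<^sub>p\<close>, so with \<open>T = {1..b} - J\<close> the ratio of the
  determinants for \<open>T\<close> and for \<open>{}\<close> is the determinant of \<open>\<psi>\<close> on \<open>E\<^sub>b / (E\<^sub>b \<inter> F\<^sub>p)\<close>. At the base point \<open>w'\<close>
  the matrix for \<open>{}\<close> is the identity.
\<close>

definition chart_mat ::
    "nat \<Rightarrow> nat set \<Rightarrow> (nat \<Rightarrow> nat) \<Rightarrow> nat set \<Rightarrow> 'a::field mat \<times> 'a mat \<Rightarrow> 'a mat" where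
  "chart_mat n J \<tau> T x = mat n n (\<lambda>(i, j).
     if j \<in> J then fst x $$ (i, \<tau> j) else if j \<in> T then snd x $$ (i, j) else if i = j then 1 else 0)"

lemma chart_mat_carrier [simp]: "chart_mat n J \<tau> T x \<in> carrier_mat n n"
  by (simp add: chart_mat_def)

text \<open>An upper triangular \<open>\<beta>\<close> recombines the first \<open>p\<close> columns
  of \<open>g\<close> among themselves, so the right factor is the leading block of
  \<open>\<beta>\<close> transported to \<open>J\<close> by \<open>\<tau>\<close>. It does not
  depend on \<open>T\<close>: all these minors scale by the same factor along a coset.\<close>

lemma chart_mat_mult_right:
  fixes g \<beta> \<psi> :: "'a::field mat"
  assumes g: "g \<in> carrier_mat n n" and \<beta>: "\<beta> \<in> carrier_mat n n" "upper_triangular \<beta>"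
    and J: "J \<subseteq> {..<n}" and p: "p \<le> n" and \<tau>: "bij_betw \<tau> J {..<p}"
  shows "chart_mat n J \<tau> T (g * \<beta>, \<psi>) = chart_mat n J \<tau> T (g, \<psi>) *
    mat n n (\<lambda>(i, j). if i \<in> J \<and> j \<in> J then \<beta> $$ (\<tau> i, \<tau> j) else if i = j then 1 else 0)"
    (is "?L = ?M * ?K")
proof (rule eq_matI)
  fix i j assume "i < dim_row (?M * ?K)" "j < dim_col (?M * ?K)"
  then have ij: "i < n" "j < n" by (simp_all add: chart_mat_def)
  have MK: "(?M * ?K) $$ (i, j) = (\<Sum>k = 0..<n. ?M $$ (i, k) * ?K $$ (k, j))"
    using ij by (simp add: scalar_prod_def chart_mat_def)
  show "?L $$ (i, j) = (?M * ?K) $$ (i, j)"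
  proof (cases "j \<in> J")
    case False
    have "(\<Sum>k = 0..<n. ?M $$ (i, k) * ?K $$ (k, j)) = (\<Sum>k = 0..<n. if k = j then ?M $$ (i, j) else 0)"
      by (rule sum.cong[OF refl]) (use ij False in auto)
    then show ?thesis unfolding MK using ij False by (simp add: chart_mat_def)
  next
    case True
    then have \<tau>j: "\<tau> j < p" using \<tau> bij_betwE by auto
    have "(\<Sum>k = 0..<n. ?M $$ (i, k) * ?K $$ (k, j))
        = (\<Sum>k \<in> {0..<n}. if k \<in> J then g $$ (i, \<tau> k) * \<beta> $$ (\<tau> k, \<tau> j) else 0)"
      by (rule sum.cong[OF refl]) (use ij True in \<open>auto simp: chart_mat_def\<close>)
    also have "\<dots> = (\<Sum>k \<in> {0..<n} \<inter> J. g $$ (i, \<tau> k) * \<beta> $$ (\<tau> k, \<tau> j))"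
      by (rule sum.inter_restrict[symmetric]) simp
    also have "{0..<n} \<inter> J = J" using J by auto
    also have "(\<Sum>k \<in> J. g $$ (i, \<tau> k) * \<beta> $$ (\<tau> k, \<tau> j)) = (\<Sum>l<p. g $$ (i, l) * \<beta> $$ (l, \<tau> j))"
      by (rule sum.reindex_bij_betw[OF \<tau>])
    also have "\<dots> = (\<Sum>l<n. g $$ (i, l) * \<beta> $$ (l, \<tau> j))"
    proof (rule sum.mono_neutral_left)
      show "\<forall>l \<in> {..<n} - {..<p}. g $$ (i, l) * \<beta> $$ (l, \<tau> j) = 0"
        using \<beta> \<tau>j upper_triangularD[OF \<beta>(2), of "\<tau> j"] by auto
    qed (use p in auto)
    also have "\<dots> = (g * \<beta>) $$ (i, \<tau> j)"
      using g \<beta> ij \<tau>j p by (simp add: scalar_prod_def lessThan_atLeast0)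
    finally show ?thesis unfolding MK using ij True by (simp add: chart_mat_def)
  qed
qed (simp_all add: chart_mat_def)

text \<open>Left multiplication by \<open>\<gamma>\<close>, the inverse of \<open>\<beta>\<close>,
  turns the columns in \<open>J\<close> into the unit vectors with indices \<open>\<rho> j\<close>,
  which run through \<open>I\<close>, and the columns of \<open>\<psi>\<close> into those of
  \<open>\<phi> * \<gamma>\<close>. By \<open>stab\<close>, \<open>\<phi>\<close> preserves the span
  of these unit vectors. Modulo that span it acts on the first \<open>m\<close> coordinates by its
  block on \<open>{..<m} - I\<close>, which is triangular with the diagonal entries of
  \<open>\<psi>\<close>.\<close>

lemma det_chart_mat_eq:
  fixes g \<psi> \<beta> \<gamma> \<phi> :: "'a::field mat"
  assumes g: "g \<in> carrier_mat n n"
    and \<psi>: "\<psi> \<in> carrier_mat n n" "upper_triangular \<psi>"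
    and \<beta>: "\<beta> \<in> carrier_mat n n" "upper_triangular \<beta>"
    and \<gamma>: "\<gamma> \<in> carrier_mat n n" "\<beta> * \<gamma> = 1\<^sub>m n"
    and \<phi>_def: "\<phi> = \<gamma> * \<psi> * \<beta>"
    and I: "I \<subseteq> {..<n}" and J: "J \<subseteq> {..<n}" and \<rho>: "bij_betw \<rho> J I"
    and g_col: "\<And>i j. i < n \<Longrightarrow> j \<in> J \<Longrightarrow> g $$ (i, \<tau> j) = \<beta> $$ (i, \<rho> j)"
    and stab: "\<And>i k. i < n \<Longrightarrow> i \<notin> I \<Longrightarrow> k \<in> I \<Longrightarrow> \<phi> $$ (i, k) = 0"
    and m: "m \<le> n" and card: "card ({..<m} - J) = card ({..<m} - I)"
  shows "det (chart_mat n J \<tau> ({..<m} - J) (g, \<psi>))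
    = (\<Prod>i \<in> {..<m} - I. \<psi> $$ (i, i)) * det (chart_mat n J \<tau> {} (g, \<psi>))"
proof -
  define T where "T = {..<m} - J"
  define T\<^sub>0 where "T\<^sub>0 = {..<m} - I"
  have \<gamma>\<beta>: "\<gamma> * \<beta> = 1\<^sub>m n"
    by (rule mat_mult_left_right_inverse[OF \<beta>(1) \<gamma>(1,2)])
  have \<gamma>ut: "upper_triangular \<gamma>"
    by (rule upper_triangular_right_inverse[OF \<beta> \<gamma>])
  have \<gamma>\<psi>: "\<gamma> * \<psi> \<in> carrier_mat n n" "upper_triangular (\<gamma> * \<psi>)"
    using \<gamma> \<psi> upper_triangular_mult(1)[OF \<gamma>(1) \<gamma>ut \<psi>] by simp_all
  have \<phi>: "\<phi> \<in> carrier_mat n n" "upper_triangular \<phi>"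
    using \<gamma>\<psi> \<beta> upper_triangular_mult(1)[OF \<gamma>\<psi> \<beta>] by (simp_all add: \<phi>_def)
  have \<phi>_diag: "\<phi> $$ (i, i) = \<psi> $$ (i, i)" if "i < n" for i
  proof -
    have "\<phi> $$ (i, i) = \<gamma> $$ (i, i) * \<psi> $$ (i, i) * \<beta> $$ (i, i)"
      using that upper_triangular_mult(2)[OF \<gamma>\<psi> \<beta>] upper_triangular_mult(2)[OF \<gamma>(1) \<gamma>ut \<psi>]
      by (simp add: \<phi>_def)
    moreover have "\<gamma> $$ (i, i) * \<beta> $$ (i, i) = 1"
      using that upper_triangular_mult(2)[OF \<gamma>(1) \<gamma>ut \<beta>] \<gamma>\<beta> by simp
    ultimately show ?thesis by (simp add: algebra_simps)
  qed
  \<comment> \<open>This form expresses the columns coming from \<open>\<psi>\<close> through those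
    of \<open>\<gamma>\<close>, which are the corresponding columns of \<open>N {}\<close>.\<close>
  have \<phi>\<gamma>: "\<phi> * \<gamma> = \<gamma> * \<psi>"
    using assoc_mult_mat[OF \<gamma>\<psi>(1) \<beta>(1) \<gamma>(1)] right_mult_one_mat[OF \<gamma>\<psi>(1)] \<gamma>(2)
    by (simp add: \<phi>_def)

  define N where "N = (\<lambda>S. \<gamma> * chart_mat n J \<tau> S (g, \<psi>))"
  have N_carrier: "N S \<in> carrier_mat n n" for S
    using \<gamma> by (simp add: N_def mult_carrier_mat[of _ n n])
  have N: "N S $$ (i, j) = (if j \<in> J then if i = \<rho> j then 1 else 0
      else if j \<in> S then (\<gamma> * \<psi>) $$ (i, j) else \<gamma> $$ (i, j))" if "i < n" "j < n" for S i j
  proof -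
    have "N S $$ (i, j) = (\<Sum>k = 0..<n. \<gamma> $$ (i, k) * chart_mat n J \<tau> S (g, \<psi>) $$ (k, j))"
      using that \<gamma> by (simp add: N_def scalar_prod_def chart_mat_def)
    also have "\<dots> = (\<Sum>k = 0..<n. \<gamma> $$ (i, k) * (if j \<in> J then \<beta> $$ (k, \<rho> j)
        else if j \<in> S then \<psi> $$ (k, j) else if k = j then 1 else 0))"
      by (rule sum.cong[OF refl]) (use that g_col in \<open>simp add: chart_mat_def\<close>)
    also have "\<dots> = (if j \<in> J then (\<gamma> * \<beta>) $$ (i, \<rho> j)
        else if j \<in> S then (\<gamma> * \<psi>) $$ (i, j) else \<gamma> $$ (i, j))"
    proof -
      have "\<rho> j < n" if "j \<in> J" using that \<rho> I bij_betwE by blast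
      moreover have "(\<Sum>k = 0..<n. \<gamma> $$ (i, k) * (if k = j then 1 else 0)) = \<gamma> $$ (i, j)"
        using that by (simp add: if_distrib[of "\<lambda>x. _ * x"] cong: if_cong)
      ultimately show ?thesis
        using that \<gamma> \<beta> \<psi> by (simp add: scalar_prod_def)
    qed
    finally show ?thesis
      using that \<rho> I bij_betwE[OF \<rho>] by (auto simp: \<gamma>\<beta>)
  qed

  \<comment> \<open>\<open>A\<close> is the action of \<open>\<phi>\<close> on the quotient,
    extended by the identity; the aim is \<open>det A * det (N {}) = det (N T)\<close>.\<close>
  define A where "A = mat n n (\<lambda>(i, j).
    if i \<in> T\<^sub>0 \<and> j \<in> T\<^sub>0 then \<phi> $$ (i, j) else if i = j then 1 else 0)"
  have A: "A \<in> carrier_mat n n" by (simp add: A_def)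
  have "upper_triangular A"
    by (rule upper_triangularI) (use \<phi> in \<open>auto simp: A_def\<close>)
  then have "det A = (\<Prod>i = 0..<n. A $$ (i, i))"
    using det_upper_triangular[OF _ A] A by (simp add: prod_list_diag_prod)
  also have "\<dots> = (\<Prod>i \<in> {0..<n}. if i \<in> T\<^sub>0 then \<psi> $$ (i, i) else 1)"
    by (rule prod.cong[OF refl]) (simp add: A_def \<phi>_diag)
  also have "\<dots> = (\<Prod>i \<in> T\<^sub>0. \<psi> $$ (i, i))"
  proof -
    have "{0..<n} \<inter> T\<^sub>0 = T\<^sub>0" using m by (auto simp: T\<^sub>0_def)
    then show ?thesis by (simp flip: prod.inter_restrict)
  qed
  finally have det_A: "det A = (\<Prod>i \<in> T\<^sub>0. \<psi> $$ (i, i))" .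

  have AN: "(A * N {}) $$ (i, j) =
      (if i \<in> T\<^sub>0 then \<Sum>k \<in> T\<^sub>0. \<phi> $$ (i, k) * N {} $$ (k, j) else N {} $$ (i, j))"
    if "i < n" "j < n" for i j
  proof -
    have *: "(A * N {}) $$ (i, j) = (\<Sum>k = 0..<n. A $$ (i, k) * N {} $$ (k, j))"
      using that A N_carrier[of "{}"] by (simp add: scalar_prod_def)
    show ?thesis
    proof (cases "i \<in> T\<^sub>0")
      case True
      have "(\<Sum>k = 0..<n. A $$ (i, k) * N {} $$ (k, j))
          = (\<Sum>k \<in> T\<^sub>0. \<phi> $$ (i, k) * N {} $$ (k, j))"
        by (rule sum.mono_neutral_cong_right) (use True that m in \<open>auto simp: A_def T\<^sub>0_def\<close>)
      then show ?thesis unfolding * using True by simp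
    next
      case False
      have "(\<Sum>k = 0..<n. A $$ (i, k) * N {} $$ (k, j))
          = (\<Sum>k = 0..<n. if k = i then N {} $$ (i, j) else 0)"
        by (rule sum.cong[OF refl]) (use False that in \<open>auto simp: A_def\<close>)
      then show ?thesis unfolding * using False that by simp
    qed
  qed
  \<comment> \<open>In the sum over all \<open>k\<close>, indices in \<open>I\<close> drop out by
    \<open>stab\<close>, and indices \<open>k \<ge> m\<close> because \<open>\<gamma>\<close> is
    upper triangular and \<open>j < m\<close>.\<close>
  have \<gamma>\<psi>_block: "(\<gamma> * \<psi>) $$ (i, j) = (\<Sum>k \<in> T\<^sub>0. \<phi> $$ (i, k) * \<gamma> $$ (k, j))"
    if "i < n" "i \<notin> I" "j < m" for i j
  proof -
    have "(\<gamma> * \<psi>) $$ (i, j) = (\<Sum>k = 0..<n. \<phi> $$ (i, k) * \<gamma> $$ (k, j))"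
      unfolding \<phi>\<gamma>[symmetric] using that m \<phi> \<gamma> by (simp add: scalar_prod_def)
    also have "\<dots> = (\<Sum>k \<in> T\<^sub>0. \<phi> $$ (i, k) * \<gamma> $$ (k, j))"
    proof (rule sum.mono_neutral_right)
      show "\<forall>k \<in> {0..<n} - T\<^sub>0. \<phi> $$ (i, k) * \<gamma> $$ (k, j) = 0"
      proof
        fix k assume k: "k \<in> {0..<n} - T\<^sub>0"
        show "\<phi> $$ (i, k) * \<gamma> $$ (k, j) = 0"
        proof (cases "k \<in> I")
          case True
          then show ?thesis using stab that by simp
        next
          case False
          then have "j < k" using k that by (auto simp: T\<^sub>0_def)
          then show ?thesis using upper_triangularD[OF \<gamma>ut, of j k] k \<gamma>(1) by simp
        qed
      qed
    qed (use m in \<open>auto simp: T\<^sub>0_def\<close>)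
    finally show ?thesis .
  qed
  have low: "\<gamma> $$ (i, j) = 0" "(\<gamma> * \<psi>) $$ (i, j) = 0" if "i < n" "j < m" "m \<le> i" for i j
    using that upper_triangularD[OF \<gamma>ut, of j i] upper_triangularD[OF \<gamma>\<psi>(2), of j i] \<gamma>(1) \<gamma>\<psi>(1)
    by simp_all

  \<comment> \<open>Both matrices are block triangular with the same diagonal blocks; \<open>B\<close> has the off-diagonal
    block of \<open>N T\<close> in the columns \<open>T\<close> and that of \<open>A * N {}\<close> elsewhere.\<close>
  define B where "B = mat n n (\<lambda>(i, j). if j \<in> T then N T $$ (i, j) else (A * N {}) $$ (i, j))"
  have B: "B \<in> carrier_mat n n" by (simp add: B_def)
  have ANc: "A * N {} \<in> carrier_mat n n"
    using A N_carrier by (rule mult_carrier_mat)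
  have JI: "card I = card J" using bij_betw_same_card[OF \<rho>] by simp
  have \<rho>I: "\<rho> j \<in> I" if "j \<in> J" for j using bij_betwE[OF \<rho>] that by blast
  have T: "j < m" "j \<notin> J" "j < n" if "j \<in> T" for j using that m by (auto simp: T_def)
  have AN_J: "(A * N {}) $$ (i, j) = (if i = \<rho> j then 1 else 0)" if "i < n" "i \<notin> I" "j \<in> J" for i j
  proof -
    have jn: "j < n" using that J by auto
    have "N {} $$ (k, j) = 0" if "k \<in> T\<^sub>0" for k
      using N[of k j "{}"] that \<open>j \<in> J\<close> \<rho>I jn m by (auto simp: T\<^sub>0_def)
    then show ?thesis using AN[of i j] N[of i j "{}"] that jn \<rho>I by auto
  qed
  \<comment> \<open>Only entries in rows \<open>I\<close> of the columns \<open>T\<close> change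
    here.\<close>
  have "det (A * N {}) = det B"
  proof (rule det_eq_off_block[OF ANc B I J JI])
    show "(A * N {}) $$ (i, j) = 0" if "i < n" "i \<notin> I" "j \<in> J" for i j
      using AN_J[OF that] \<rho>I that by auto
    show "(A * N {}) $$ (i, j) = B $$ (i, j)" if "i < n" "j < n" "i \<notin> I \<or> j \<in> J" for i j
    proof (cases "j \<in> T")
      case True
      then have i: "i \<notin> I" and j: "j < m" "j \<notin> J" using that T by auto
      have Nj: "N {} $$ (k, j) = \<gamma> $$ (k, j)" if "k < n" for k
        using N[OF that \<open>j < n\<close>] j by simp
      have "N T $$ (i, j) = (\<gamma> * \<psi>) $$ (i, j)"
        using N[OF that(1,2)] True j by simp
      moreover have "(A * N {}) $$ (i, j) = (\<gamma> * \<psi>) $$ (i, j)"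
      proof (cases "i \<in> T\<^sub>0")
        case True
        then have "(A * N {}) $$ (i, j) = (\<Sum>k \<in> T\<^sub>0. \<phi> $$ (i, k) * N {} $$ (k, j))"
          using AN that by simp
        also have "\<dots> = (\<Sum>k \<in> T\<^sub>0. \<phi> $$ (i, k) * \<gamma> $$ (k, j))"
          by (rule sum.cong[OF refl]) (use Nj m in \<open>auto simp: T\<^sub>0_def\<close>)
        finally show ?thesis using \<gamma>\<psi>_block that i j by simp
      next
        case False
        then have "m \<le> i" using i by (auto simp: T\<^sub>0_def)
        then show ?thesis using AN[of i j] Nj[of i] low[of i j] that j False by simp
      qed
      ultimately show ?thesis using that True by (simp add: B_def)
    qed (use that in \<open>simp add: B_def\<close>)
  qed
  \<comment> \<open>Now only entries in rows \<open>T\<^sub>0\<close> of the columns outside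
    \<open>J \<union> T\<close> change; \<open>card\<close> makes the enlarged block square.\<close>
  also have "\<dots> = det (N T)"
  proof (rule det_eq_off_block[OF B N_carrier, of "I \<union> T\<^sub>0" "J \<union> T"])
    show "I \<union> T\<^sub>0 \<subseteq> {..<n}" "J \<union> T \<subseteq> {..<n}"
      using I J m by (auto simp: T_def T\<^sub>0_def)
    then have "finite I" "finite J" "finite T" "finite T\<^sub>0"
      by (meson finite_Un finite_subset finite_lessThan)+
    then show "card (I \<union> T\<^sub>0) = card (J \<union> T)"
      using JI card by (subst (1 2) card_Un_disjoint) (auto simp: T_def T\<^sub>0_def)
    show "B $$ (i, j) = 0" if "i < n" "i \<notin> I \<union> T\<^sub>0" "j \<in> J \<union> T" for i j
    proof (cases "j \<in> T")
      case True
      then have "m \<le> i" using that by (auto simp: T\<^sub>0_def)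
      then show ?thesis using N[of i j T] low T[OF True] that True by (simp add: B_def)
    next
      case False
      then have "j \<in> J" "j < n" using that J by auto
      then show ?thesis using AN_J[of i j] \<rho>I that False by (auto simp: B_def)
    qed
    show "B $$ (i, j) = N T $$ (i, j)" if "i < n" "j < n" "i \<notin> I \<union> T\<^sub>0 \<or> j \<in> J \<union> T" for i j
    proof (cases "j \<in> T")
      case False
      have "(A * N {}) $$ (i, j) = N T $$ (i, j)"
      proof (cases "j \<in> J")
        case True
        show ?thesis
        proof (cases "i \<in> T\<^sub>0")
          case i: True
          then have "i \<notin> I" by (simp add: T\<^sub>0_def)
          then show ?thesis using AN_J[of i j] N[of i j T] that True by simp
        next
          case i: False
          then show ?thesis using AN[of i j] N[of i j T] N[of i j "{}"] that True by simp
        qed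
      next
        case j: False
        then show ?thesis using AN[of i j] N[of i j T] N[of i j "{}"] that False by simp
      qed
      then show ?thesis using that False by (simp add: B_def)
    qed (use that in \<open>simp add: B_def\<close>)
  qed
  finally have "det A * det (N {}) = det (N T)"
    using det_mult[OF A N_carrier] by simp
  moreover have "det (N S) = det \<gamma> * det (chart_mat n J \<tau> S (g, \<psi>))" for S
    unfolding N_def by (rule det_mult[OF \<gamma>(1)]) simp
  moreover have "det \<gamma> \<noteq> 0"
    using det_mult[OF \<beta>(1) \<gamma>(1)] \<gamma>(2) by auto
  ultimately show ?thesis
    unfolding T_def[symmetric] T\<^sub>0_def[symmetric] using det_A by simp
qed

section \<open>Index sets of the two permutations\<close>

text \<open>The assumption \<open>sub\<close> embeds the complement for \<open>w\<close> without
  \<open>a\<close> into the complement for \<open>w'\<close> without \<open>b\<close>. The rank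
  inequality bounds the cardinalities in the opposite direction, so the two sets coincide.\<close>

lemma complement_exchange:
  assumes w: "w permutes {1..n}" and w': "w' permutes {1..n}" and le: "bruhat_le n w' w"
    and p: "p \<le> n" and ab: "1 \<le> a" "a < b"
    and a: "a \<notin> w ` {1..p}" "a \<in> w' ` {1..p}" and b: "b \<in> w ` {1..p}" "b \<notin> w' ` {1..p}"
    and sub: "\<forall>i \<in> w' ` {1..p}. i \<noteq> a \<and> i < b \<longrightarrow> i \<in> w ` {1..p}"
  obtains S where "{1..b} - w' ` {1..p} = insert b S" "{1..b} - w ` {1..p} = insert a S"
    "a \<notin> S" "b \<notin> S" "finite S"
proof -
  have card: "card ({1..b} - v ` {1..p}) = b - card {x \<in> {1..p}. v x \<le> b}"
    if v: "v permutes {1..n}" for v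
  proof -
    have "{1..b} \<inter> v ` {1..p} = v ` {x \<in> {1..p}. v x \<le> b}"
      using permutes_in_image[OF v] p by force
    moreover have "card (v ` {x \<in> {1..p}. v x \<le> b}) = card {x \<in> {1..p}. v x \<le> b}"
      by (rule card_image[OF permutes_inj_on[OF v]])
    ultimately show ?thesis by (simp add: card_Diff_subset_Int)
  qed
  define T where "T = {1..b} - w' ` {1..p}"
  define T\<^sub>0 where "T\<^sub>0 = {1..b} - w ` {1..p}"
  define S where "S = T - {b}"
  have fin: "finite T" "finite T\<^sub>0" by (simp_all add: T_def T\<^sub>0_def)
  have "b \<in> T" "a \<in> T\<^sub>0" using a b ab by (auto simp: T_def T\<^sub>0_def)
  have "card T \<le> card T\<^sub>0"
    using bruhat_le_card_le[OF le, of p b] unfolding T_def T\<^sub>0_def card[OF w] card[OF w'] by simp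
  then have "card S \<le> card (T\<^sub>0 - {a})"
    using fin \<open>b \<in> T\<close> \<open>a \<in> T\<^sub>0\<close> by (simp add: S_def card_Diff_singleton)
  moreover have "T\<^sub>0 - {a} \<subseteq> S"
  proof
    fix i assume "i \<in> T\<^sub>0 - {a}"
    moreover from this have "i \<noteq> b" using b by (auto simp: T\<^sub>0_def)
    ultimately show "i \<in> S" using sub unfolding S_def T_def T\<^sub>0_def by force
  qed
  ultimately have "T\<^sub>0 - {a} = S"
    using fin by (intro card_seteq) (auto simp: S_def)
  then have "T = insert b S" "T\<^sub>0 = insert a S" "a \<notin> S" "b \<notin> S" "finite S"
    using \<open>b \<in> T\<close> \<open>a \<in> T\<^sub>0\<close> fin by (auto simp: S_def)
  then show ?thesis using that unfolding T_def T\<^sub>0_def by blast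
qed

lemma bij_betw_perm_shift:
  assumes v: "v permutes {1..n}" and p: "p \<le> n"
  shows "bij_betw (\<lambda>l. v (Suc l) - 1) {..<p} {j. Suc j \<in> v ` {1..p}}"
    and "bij_betw (\<lambda>j. inv_into UNIV v (Suc j) - 1) {j. Suc j \<in> v ` {1..p}} {..<p}"
proof -
  let ?v = "inv_into UNIV v"
  \<comment> \<open>Values of \<open>v\<close> on \<open>{1..n}\<close> are positive, so the
    truncated subtraction in the passage to 0-based indices loses nothing.\<close>
  have pos: "Suc (v (Suc l) - 1) = v (Suc l)" if "l < p" for l
    using permutes_in_image[OF v, of "Suc l"] that p by auto
  have inv: "?v (v x) = x" for x using permutes_inverses(2)[OF v] .
  have 1: "\<forall>l \<in> {..<p}. ?v (Suc (v (Suc l) - 1)) - 1 = l"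
    using pos inv by simp
  have 2: "\<forall>j \<in> {j. Suc j \<in> v ` {1..p}}. v (Suc (?v (Suc j) - 1)) - 1 = j"
  proof
    fix j assume "j \<in> {j. Suc j \<in> v ` {1..p}}"
    then obtain x where x: "Suc j = v x" "x \<in> {1..p}" by blast
    then have "Suc (?v (Suc j) - 1) = x" using inv by simp
    then show "v (Suc (?v (Suc j) - 1)) - 1 = j" using x(1) by simp
  qed
  have 3: "(\<lambda>l. v (Suc l) - 1) ` {..<p} \<subseteq> {j. Suc j \<in> v ` {1..p}}"
    using pos by auto
  have 4: "(\<lambda>j. ?v (Suc j) - 1) ` {j. Suc j \<in> v ` {1..p}} \<subseteq> {..<p}"
    using inv by auto
  show "bij_betw (\<lambda>l. v (Suc l) - 1) {..<p} {j. Suc j \<in> v ` {1..p}}"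
    by (rule bij_betw_byWitness[OF 1 2 3 4])
  show "bij_betw (\<lambda>j. ?v (Suc j) - 1) {j. Suc j \<in> v ` {1..p}} {..<p}"
    by (rule bij_betw_byWitness[OF 2 1 4 3])
qed

section \<open>Polynomial functions over the base field\<close>

lemma poly_functions_sum:
  assumes "finite A" "\<And>a. a \<in> A \<Longrightarrow> f a \<in> poly_functions n"
  shows "(\<lambda>x. \<Sum>a \<in> A. f a x) \<in> poly_functions n"
  using assms by (induction A rule: finite_induct)
    (use poly_functions.const[of 0] in \<open>auto intro: poly_functions.add\<close>)

lemma poly_functions_prod:
  assumes "finite A" "\<And>a. a \<in> A \<Longrightarrow> f a \<in> poly_functions n"
  shows "(\<lambda>x. \<Prod>a \<in> A. f a x) \<in> poly_functions n"
  using assms by (induction A rule: finite_induct)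
    (use poly_functions.const[of 1] in \<open>auto intro: poly_functions.mult\<close>)

lemma poly_functions_det:
  assumes "\<And>i j. i < n \<Longrightarrow> j < n \<Longrightarrow> E i j \<in> poly_functions n"
  shows "(\<lambda>x. det (mat n n (\<lambda>(i, j). E i j x))) \<in> poly_functions n"
proof -
  \<comment> \<open>The signs are written through \<open>to_ac\<close> because constants in
    \<open>poly_functions\<close> must come from the base field.\<close>
  have "(\<lambda>x. \<Sum>p \<in> {p. p permutes {0..<n}}. to_ac (of_int (sign p)) * (\<Prod>i \<in> {0..<n}. E i (p i) x))
      \<in> poly_functions n"
  proof (intro poly_functions_sum poly_functions_prod poly_functions.mult poly_functions.const
      finite_permutations finite_atLeastLessThan)
    fix p i assume "p \<in> {p. p permutes {0..<n}}" "i \<in> {0..<n}"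
    then show "E i (p i) \<in> poly_functions n"
      using assms permutes_in_image[of p "{0..<n}" i] by simp
  qed
  moreover have "det (mat n n (\<lambda>(i, j). E i j x)) =
      (\<Sum>p \<in> {p. p permutes {0..<n}}. to_ac (of_int (sign p)) * (\<Prod>i \<in> {0..<n}. E i (p i) x))" for x
    unfolding det_def'[OF mat_carrier]
  proof (rule sum.cong[OF refl])
    fix p assume "p \<in> {p. p permutes {0..<n}}"
    then have "p i < n" if "i < n" for i using permutes_in_image[of p "{0..<n}" i] that by simp
    then show "signof p * (\<Prod>i = 0..<n. mat n n (\<lambda>(i, j). E i j x) $$ (i, p i)) =
        to_ac (of_int (sign p)) * (\<Prod>i \<in> {0..<n}. E i (p i) x)"
      by simp
  qed
  ultimately show ?thesis by simp
qed

lemma poly_functions_diff: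
  assumes "f \<in> poly_functions n" "h \<in> poly_functions n"
  shows "(\<lambda>x. f x - h x) \<in> poly_functions n"
  using poly_functions.add[OF assms(1) poly_functions.mult[OF poly_functions.const[of "-1"] assms(2)]]
  by simp

lemma poly_functions_det_chart_mat:
  assumes "\<And>j. j \<in> J \<Longrightarrow> \<tau> j < n"
  shows "(\<lambda>x. det (chart_mat n J \<tau> T x)) \<in> poly_functions n"
  unfolding chart_mat_def
proof (rule poly_functions_det)
  fix i j assume ij: "i < n" "j < n"
  show "(\<lambda>x. if j \<in> J then fst x $$ (i, \<tau> j) else if j \<in> T then snd x $$ (i, j)
      else if i = j then 1 else 0) \<in> poly_functions n"
    using poly_functions.const[of 0] poly_functions.const[of 1] ij assms
      poly_functions.entry_fst[of i n "\<tau> j"] poly_functions.entry_snd[of i n j]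
    by (cases "j \<in> J"; cases "j \<in> T"; cases "i = j") (simp_all add: case_prod_unfold)
qed

section \<open>The general linear group, flags and permutation matrices\<close>

lemma carrier_GL_iff:
  "g \<in> carrier (GL n) \<longleftrightarrow>
     g \<in> carrier_mat n n \<and> (\<exists>h \<in> carrier_mat n n. h * g = 1\<^sub>m n \<and> g * h = 1\<^sub>m n)"
  by (auto simp: GL_def units_of_def Units_def ring_mat_def)

lemma mult_GL: "g \<otimes>\<^bsub>GL n\<^esub> h = g * h"
  by (simp add: GL_def units_of_def ring_mat_def)

lemma one_GL: "\<one>\<^bsub>GL n\<^esub> = 1\<^sub>m n"
  by (simp add: GL_def units_of_def ring_mat_def)

lemma group_GL: "group (GL n :: 'a::field mat monoid)"
  unfolding GL_def
  by (rule monoid.units_group, rule semiring.axioms(2)[OF semiring_mat])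

lemma GL_inv:
  fixes g :: "'a::field mat"
  assumes "g \<in> carrier (GL n)"
  shows "inv\<^bsub>GL n\<^esub> g \<in> carrier (GL n)" "inv\<^bsub>GL n\<^esub> g * g = 1\<^sub>m n" "g * inv\<^bsub>GL n\<^esub> g = 1\<^sub>m n"
  using group.inv_closed[OF group_GL assms] group.l_inv[OF group_GL assms]
    group.r_inv[OF group_GL assms]
  by (simp_all add: mult_GL one_GL)

lemma carrier_GL_mat: "g \<in> carrier (GL n) \<Longrightarrow> g \<in> carrier_mat n n"
  by (simp add: carrier_GL_iff)

lemma GL_mult_closed:
  fixes g :: "'a::field mat"
  assumes "g \<in> carrier (GL n)" "h \<in> carrier (GL n)"
  shows "g * h \<in> carrier (GL n)"
  using monoid.m_closed[OF group.is_monoid[OF group_GL] assms] by (simp add: mult_GL)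

lemma one_borel: "(1\<^sub>m n :: 'a::field mat) \<in> borel_subgroup n"
  by (auto simp: borel_subgroup_def carrier_GL_iff intro!: bexI[of _ "1\<^sub>m n"])

lemma flag_coset_eq: "flag_coset n g = {g * \<beta> | \<beta>. \<beta> \<in> borel_subgroup n}"
  unfolding flag_coset_def l_coset_def mult_GL by blast

lemma flag_coset_eqD:
  fixes g :: "'a::field mat"
  assumes "flag_coset n g = flag_coset n h" and g: "g \<in> carrier (GL n)"
  obtains \<beta> where "\<beta> \<in> borel_subgroup n" "g = h * \<beta>"
proof -
  have "g = g * 1\<^sub>m n" using right_mult_one_mat[OF carrier_GL_mat[OF g]] by simp
  then have "g \<in> flag_coset n g" using one_borel[of n] unfolding flag_coset_eq by blast
  then show ?thesis using that unfolding assms(1) unfolding flag_coset_eq by blast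
qed

lemma perm_mat_carrier [simp]: "perm_mat n v \<in> carrier_mat n n"
  by (simp add: perm_mat_def)

lemma mult_perm_mat:
  assumes A: "A \<in> carrier_mat n n" and v: "v permutes {1..n}" and ij: "i < n" "j < n"
  shows "(A * perm_mat n v) $$ (i, j) = A $$ (i, v (Suc j) - 1)"
proof -
  have v1: "1 \<le> v (Suc j)" "v (Suc j) \<le> n"
    using permutes_in_image[OF v, of "Suc j"] ij by auto
  have "(A * perm_mat n v) $$ (i, j) = (\<Sum>k = 0..<n. A $$ (i, k) * perm_mat n v $$ (k, j))"
    using A ij by (simp add: scalar_prod_def perm_mat_def)
  also have "\<dots> = (\<Sum>k = 0..<n. if k = v (Suc j) - 1 then A $$ (i, v (Suc j) - 1) else 0)"
    by (rule sum.cong[OF refl]) (use ij v1 in \<open>auto simp: perm_mat_def\<close>)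
  finally show ?thesis using v1 by simp
qed

lemma perm_mat_mult:
  assumes A: "A \<in> carrier_mat n n" and v: "v permutes {1..n}" and ij: "i < n" "j < n"
  shows "(perm_mat n v * A) $$ (i, j) = A $$ (inv_into UNIV v (Suc i) - 1, j)"
proof -
  have "inv_into UNIV v (Suc i) \<in> {1..n}"
    using permutes_in_image[OF permutes_inv[OF v], of "Suc i"] ij by simp
  then obtain c where c: "inv_into UNIV v (Suc i) = Suc c" "c < n"
    by (cases "inv_into UNIV v (Suc i)") auto
  have eq: "Suc i = v (Suc k) \<longleftrightarrow> k = c" for k
    using permutes_inv_eq[OF v, of "Suc i" "Suc k"] unfolding c by auto
  have "(perm_mat n v * A) $$ (i, j) = (\<Sum>k = 0..<n. perm_mat n v $$ (i, k) * A $$ (k, j))"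
    using A ij by (simp add: scalar_prod_def perm_mat_def)
  also have "\<dots> = (\<Sum>k = 0..<n. if k = c then A $$ (c, j) else 0)"
    by (rule sum.cong[OF refl]) (use ij in \<open>simp add: perm_mat_def eq\<close>)
  also have "\<dots> = A $$ (c, j)" using c(2) by simp
  finally show ?thesis unfolding c by simp
qed

lemma perm_mat_GL:
  assumes v: "v permutes {1..n}"
  shows "(perm_mat n v :: 'a::field mat) \<in> carrier (GL n)"
proof -
  let ?v = "inv_into UNIV v"
  have "(perm_mat n ?v :: 'a mat) * perm_mat n v = 1\<^sub>m n"
  proof (rule eq_matI)
    fix i j assume "i < dim_row (1\<^sub>m n :: 'a mat)" "j < dim_col (1\<^sub>m n :: 'a mat)"
    then have ij: "i < n" "j < n" by simp_all
    then have "v (Suc j) \<in> {1..n}"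
      using permutes_in_image[OF v, of "Suc j"] by simp
    then obtain c where c: "v (Suc j) = Suc c" "c < n"
      by (cases "v (Suc j)") auto
    then have "?v (Suc c) = Suc j" using permutes_inverses(2)[OF v, of "Suc j"] by simp
    then show "((perm_mat n ?v :: 'a mat) * perm_mat n v) $$ (i, j) = 1\<^sub>m n $$ (i, j)"
      using mult_perm_mat[OF perm_mat_carrier[of n ?v] v ij] ij c by (simp add: perm_mat_def)
  qed (simp_all add: perm_mat_def)
  moreover from this have "perm_mat n v * (perm_mat n ?v :: 'a mat) = 1\<^sub>m n"
    by (rule mat_mult_left_right_inverse[OF perm_mat_carrier perm_mat_carrier])
  ultimately show ?thesis
    unfolding carrier_GL_iff by (intro conjI bexI[of _ "perm_mat n ?v"]) simp_all
qed

text \<open>Reduces conjugation to an intertwining relation, so that no inverse has to be computed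
  entrywise.\<close>

lemma Ad_eqI:
  fixes g :: "'a::field mat"
  assumes g: "g \<in> carrier (GL n)" and A: "A \<in> carrier_mat n n" "A' \<in> carrier_mat n n"
    and eq: "g * A = A' * g"
  shows "Ad n g A = A'"
  unfolding Ad_def eq
  using assoc_mult_mat[OF A(2) carrier_GL_mat[OF g] carrier_GL_mat[OF GL_inv(1)[OF g]]]
    GL_inv(3)[OF g] right_mult_one_mat[OF A(2)] by simp

section \<open>Separating a point from the closure by one equation\<close>

text \<open>By \<open>inv\<close> the nonvanishing locus is a union of fibres of the quotient map,
  hence equal to the preimage of its image. One implication suffices, as either of two
  representatives of a coset is the other times a Borel element.\<close>

lemma openin_zariski_flag_image:
  fixes f :: "'k::field alg_closure mat \<times> 'k alg_closure mat \<Rightarrow> 'k alg_closure"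
  assumes f: "f \<in> poly_functions n"
    and inv: "\<And>g \<beta> \<psi>. g \<in> carrier (GL n) \<Longrightarrow> \<beta> \<in> borel_subgroup n \<Longrightarrow> f (g * \<beta>, \<psi>) \<noteq> 0 \<Longrightarrow> f (g, \<psi>) \<noteq> 0"
  shows "openin (zariski_flag n)
    ((\<lambda>(g, \<psi>). (flag_coset n g, \<psi>)) ` {x \<in> carrier (GL n) \<times> lie_b n. f x \<noteq> 0})"
    (is "openin _ (?q ` ?D)")
proof -
  have quot: "quotient_map (zariski_group n :: ('k alg_closure mat \<times> 'k alg_closure mat) topology)
      (zariski_flag n) ?q"
    by (rule quotient_map_zariski_flag)
  have "?q ` ?D \<subseteq> topspace (zariski_flag n)"
    using quotient_imp_surjective_map[OF quot] unfolding topspace_zariski_group by blast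
  moreover have "{x \<in> topspace (zariski_group n). ?q x \<in> ?q ` ?D} = ?D"
  proof -
    have "f (g, \<psi>) \<noteq> 0" if g: "g \<in> carrier (GL n)" and h: "h \<in> carrier (GL n)" "f (h, \<psi>) \<noteq> 0"
      and eq: "flag_coset n h = flag_coset n g" for g h \<psi>
    proof -
      obtain \<beta> where "\<beta> \<in> borel_subgroup n" "h = g * \<beta>"
        using flag_coset_eqD[OF eq h(1)] by blast
      then show ?thesis using inv g h(2) by blast
    qed
    then have "x \<in> ?D" if "x \<in> carrier (GL n) \<times> lie_b n" "?q x \<in> ?q ` ?D" for x
      using that by (cases x) (simp add: image_iff case_prod_unfold, blast)
    then show ?thesis unfolding topspace_zariski_group by blast
  qed
  moreover have "openin (zariski_group n) ?D"
    unfolding zariski_group_def by (rule topology_generated_by_Basis) (use f in blast)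
  ultimately show ?thesis
    using quot unfolding quotient_map_def by (elim conjE allE[of _ "?q ` ?D"]) simp
qed

text \<open>The image of the nonvanishing locus of \<open>f\<close> is an open neighbourhood of the
  point. If the point were in the closure, this neighbourhood would meet \<open>V_tilde n w\<close>,
  whereas \<open>van\<close> kills \<open>f\<close> at the representatives
  \<open>\<beta> * perm_mat n w\<close> and \<open>inv\<close> spreads this to their cosets. The
  relation with \<open>U\<close> in \<open>van\<close> is the condition defining
  \<open>X_tilde\<close>, freed of inverses.\<close>

lemma not_in_X_tilde_w:
  fixes f :: "'k::field alg_closure mat \<times> 'k alg_closure mat \<Rightarrow> 'k alg_closure"
  assumes f: "f \<in> poly_functions n"
    and inv: "\<And>g \<beta> \<psi>. g \<in> carrier (GL n) \<Longrightarrow> \<beta> \<in> borel_subgroup n \<Longrightarrow> f (g * \<beta>, \<psi>) \<noteq> 0 \<Longrightarrow> f (g, \<psi>) \<noteq> 0"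
    and w: "w permutes {1..n}"
    and van: "\<And>\<beta> \<psi> U. \<beta> \<in> borel_subgroup n \<Longrightarrow> \<psi> \<in> lie_b n \<Longrightarrow> U \<in> lie_b n \<Longrightarrow>
      \<psi> * (\<beta> * perm_mat n w) = \<beta> * perm_mat n w * U \<Longrightarrow> f (\<beta> * perm_mat n w, \<psi>) = 0"
    and g: "g \<in> carrier (GL n)" and \<psi>: "\<psi> \<in> lie_b n" and nz: "f (g, \<psi>) \<noteq> 0"
  shows "(flag_coset n g, \<psi>) \<notin> X_tilde_w n w"
proof
  let ?q = "\<lambda>(g, \<psi>). (flag_coset n g, \<psi>)"
  let ?D = "{x \<in> carrier (GL n) \<times> lie_b n. f x \<noteq> 0}"
  assume "(flag_coset n g, \<psi>) \<in> X_tilde_w n w"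
  then have cl: "(flag_coset n g, \<psi>) \<in>
      Abstract_Topology.closure_of (subtopology (zariski_flag n) (X_tilde n)) (V_tilde n w)"
    by (simp add: X_tilde_w_def)
  then have "(flag_coset n g, \<psi>) \<in> X_tilde n"
    using closure_of_subset_topspace[THEN subsetD, OF cl] by simp
  moreover have "(flag_coset n g, \<psi>) \<in> ?q ` ?D"
    by (rule image_eqI[of _ _ "(g, \<psi>)"]) (simp_all add: g \<psi> nz)
  ultimately have mem: "(flag_coset n g, \<psi>) \<in> X_tilde n \<inter> ?q ` ?D" by (rule IntI)
  have op: "openin (subtopology (zariski_flag n) (X_tilde n)) (X_tilde n \<inter> ?q ` ?D)"
    using openin_zariski_flag_image[OF f inv] by (rule openin_subtopology_Int2)
  obtain y where "y \<in> V_tilde n w" "y \<in> X_tilde n \<inter> ?q ` ?D"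
    using cl[unfolded in_closure_of, THEN conjunct2, rule_format, OF conjI, OF mem op] by blast
  then obtain h \<phi> where h: "h \<in> carrier (GL n)" and \<phi>: "\<phi> \<in> lie_b n" and fh: "f (h, \<phi>) \<noteq> 0"
    and V: "(flag_coset n h, \<phi>) \<in> V_tilde n w"
    by (force simp: case_prod_unfold)
  obtain \<beta> where \<beta>: "\<beta> \<in> borel_subgroup n" "flag_coset n h = flag_coset n (\<beta> * perm_mat n w)"
    using V by (auto simp: V_tilde_def schubert_cell_def)
  obtain g' where g': "g' \<in> carrier (GL n)" "flag_coset n h = flag_coset n g'"
    and Ad: "Ad n (inv\<^bsub>GL n\<^esub> g') \<phi> \<in> lie_b n"
    using V by (auto simp: V_tilde_def X_tilde_def)
  let ?x = "\<beta> * perm_mat n w"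
  have \<beta>c: "\<beta> \<in> carrier (GL n)" "\<beta> \<in> carrier_mat n n"
    using \<beta>(1) by (simp_all add: borel_subgroup_def carrier_GL_mat)
  have x: "?x \<in> carrier (GL n)"
    using \<beta>c perm_mat_GL[OF w] by (intro GL_mult_closed)
  note xc = carrier_GL_mat[OF x]
  obtain \<beta>1 where \<beta>1: "\<beta>1 \<in> borel_subgroup n" "h = ?x * \<beta>1"
    using flag_coset_eqD[OF \<beta>(2) h] by blast
  \<comment> \<open>Membership in \<open>X_tilde\<close> is witnessed by some representative
    \<open>g'\<close>, not by \<open>?x\<close>. The elements \<open>\<beta>2\<close> and
    \<open>\<beta>3\<close> pass between the two and turn the matrix \<open>U\<close> for
    \<open>g'\<close> into the upper triangular \<open>\<beta>3 * (U * \<beta>2)\<close> for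
    \<open>?x\<close>.\<close>
  obtain \<beta>2 where \<beta>2: "\<beta>2 \<in> borel_subgroup n" "?x = g' * \<beta>2"
    using flag_coset_eqD[OF trans[OF \<beta>(2)[symmetric] g'(2)] x] by blast
  obtain \<beta>3 where \<beta>3: "\<beta>3 \<in> borel_subgroup n" "g' = ?x * \<beta>3"
    using flag_coset_eqD[OF trans[OF g'(2)[symmetric] \<beta>(2)] g'(1)] by blast
  have bc: "\<beta>2 \<in> carrier_mat n n" "upper_triangular \<beta>2" "\<beta>3 \<in> carrier_mat n n" "upper_triangular \<beta>3"
    using \<beta>2(1) \<beta>3(1) by (simp_all add: borel_subgroup_def carrier_GL_mat)
  let ?i = "inv\<^bsub>GL n\<^esub> g'"
  define U where "U = Ad n ?i \<phi>"
  have U: "U \<in> carrier_mat n n" "upper_triangular U" using Ad by (simp_all add: U_def lie_b_def)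
  have gi: "?i \<in> carrier (GL n)" "?i * g' = 1\<^sub>m n" "g' * ?i = 1\<^sub>m n"
    using GL_inv[OF g'(1)] by simp_all
  note g'c = carrier_GL_mat[OF g'(1)] and gic = carrier_GL_mat[OF gi(1)]
  have \<phi>c: "\<phi> \<in> carrier_mat n n" using \<phi> by (simp add: lie_b_def)
  have "inv\<^bsub>GL n\<^esub> ?i = g'"
    using group.inv_inv[OF group_GL g'(1)] .
  then have "U = ?i * \<phi> * g'" by (simp add: U_def Ad_def)
  then have "g' * U = g' * (?i * (\<phi> * g'))"
    using assoc_mult_mat[OF gic \<phi>c g'c] by simp
  also have "\<dots> = (g' * ?i) * (\<phi> * g')"
    using assoc_mult_mat[OF g'c gic, of "\<phi> * g'" n] \<phi>c g'c by simp
  also have "\<dots> = \<phi> * g'"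
    using gi(3) left_mult_one_mat[of "\<phi> * g'" n n] \<phi>c g'c by simp
  finally have comm: "\<phi> * g' = g' * U" by (rule sym)
  have "\<phi> * ?x = \<phi> * g' * \<beta>2"
    unfolding \<beta>2(2) by (rule assoc_mult_mat[OF \<phi>c g'c bc(1), symmetric])
  also have "\<dots> = g' * (U * \<beta>2)"
    unfolding comm by (rule assoc_mult_mat[OF g'c U(1) bc(1)])
  also have "\<dots> = ?x * (\<beta>3 * (U * \<beta>2))"
  proof -
    have "U * \<beta>2 \<in> carrier_mat n n" using U bc by simp
    from assoc_mult_mat[OF xc bc(3) this] show ?thesis unfolding \<beta>3(2)[symmetric] .
  qed
  finally have eq: "\<phi> * ?x = ?x * (\<beta>3 * (U * \<beta>2))" .
  have U2: "U * \<beta>2 \<in> carrier_mat n n" "upper_triangular (U * \<beta>2)"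
    using U bc upper_triangular_mult(1)[OF U bc(1,2)] by simp_all
  then have "\<beta>3 * (U * \<beta>2) \<in> lie_b n"
    using upper_triangular_mult(1)[OF bc(3,4) U2] bc(3) by (simp add: lie_b_def)
  then have "f (?x, \<phi>) = 0" using van[OF \<beta>(1) \<phi> _ eq] by blast
  then show False using inv[OF x \<beta>1(1), of \<phi>] fh \<beta>1(2) by blast
qed

section \<open>The separating equation and the diagonal test point\<close>

lemma det_diagonal_mat:
  fixes d :: "nat \<Rightarrow> 'a::field"
  shows "det (mat n n (\<lambda>(i, j). if i = j then d i else 0)) = (\<Prod>i = 0..<n. d i)"
  by (subst det_upper_triangular[of _ n]) (auto simp: prod_list_diag_prod)

theorem theorem5p3p7:
  fixes n a b q\<^sub>0 :: nat and w w' :: "nat \<Rightarrow> nat"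
  assumes "n \<ge> 1"
    and "w permutes {1..n}" and "w' permutes {1..n}"
    and "bruhat_le n w' w"
    and "a \<in> {1..n}" and "b \<in> {1..n}" and "a < b" and "q\<^sub>0 \<in> {1..n - 2}"
    and "a \<notin> w ` {1..q\<^sub>0 + 1}" and "a \<in> w' ` {1..q\<^sub>0 + 1}"
    and "b \<in> w ` {1..q\<^sub>0 + 1}" and "b \<notin> w' ` {1..q\<^sub>0 + 1}"
    and "\<forall>i \<in> w' ` {1..q\<^sub>0 + 1}. i \<noteq> a \<and> i < b \<longrightarrow> i \<in> w ` {1..q\<^sub>0 + 1}"
    and "b \<notin> orbit (w \<circ> inv_into UNIV w') a"
  shows "\<not> V_tilde n w' \<inter>
      q_preimage n {s + x | s x. s \<in> lie_t_fixed n (w \<circ> inv_into UNIV w') \<and> x \<in> lie_u n}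
    \<subseteq> (X_tilde_w n w ::
         ('k::field_char_0 alg_closure mat set \<times> 'k alg_closure mat) set)"
proof -
  define p where "p = q\<^sub>0 + 1"
  have p: "p \<le> n" using assms(8) by (auto simp: p_def)
  note w = assms(2) and w' = assms(3)
  let ?w' = "inv_into UNIV w'"
  let ?w = "inv_into UNIV w"
  define \<sigma> where "\<sigma> = w \<circ> ?w'"
  have \<sigma>: "\<sigma> permutes {1..n}"
    unfolding \<sigma>_def by (rule permutes_compose[OF permutes_inv[OF w'] w])
  obtain S where S: "{1..b} - w' ` {1..p} = insert b S" "{1..b} - w ` {1..p} = insert a S"
      "a \<notin> S" "b \<notin> S" "finite S"
  proof (rule complement_exchange[OF w w' assms(4) p])
    show "1 \<le> a" "a < b" using assms by auto
    show "a \<notin> w ` {1..p}" "a \<in> w' ` {1..p}" "b \<in> w ` {1..p}" "b \<notin> w' ` {1..p}"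
      "\<forall>i \<in> w' ` {1..p}. i \<noteq> a \<and> i < b \<longrightarrow> i \<in> w ` {1..p}"
      using assms unfolding p_def by simp_all
  qed blast
  define J where "J = {j. Suc j \<in> w' ` {1..p}}"
  define I where "I = {j. Suc j \<in> w ` {1..p}}"
  \<comment> \<open>\<open>\<tau> j\<close> is the column in which \<open>perm_mat n w'\<close> has
    its entry 1 of row \<open>j\<close>; \<open>\<rho>\<close> is the 0-based form of
    \<open>w \<circ> ?w'\<close> on \<open>J\<close>.\<close>
  define \<tau> where "\<tau> = (\<lambda>j. ?w' (Suc j) - 1)"
  define \<rho> where "\<rho> = (\<lambda>l. w (Suc l) - 1) \<circ> \<tau>"
  have \<tau>: "bij_betw \<tau> J {..<p}"
    unfolding \<tau>_def J_def by (rule bij_betw_perm_shift(2)[OF w' p])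
  have \<rho>: "bij_betw \<rho> J I"
    unfolding \<rho>_def I_def by (rule bij_betw_trans[OF \<tau> bij_betw_perm_shift(1)[OF w p]])
  have \<tau>p: "\<tau> j < p" if "j \<in> J" for j using bij_betwE[OF \<tau>] that by blast
  have J: "J \<subseteq> {..<n}"
  proof
    fix j assume "j \<in> J"
    then obtain x where "Suc j = w' x" "x \<in> {1..p}" by (auto simp: J_def)
    then show "j \<in> {..<n}" using permutes_in_image[OF w', of x] p by auto
  qed
  have I: "I \<subseteq> {..<n}"
  proof
    fix j assume "j \<in> I"
    then obtain x where "Suc j = w x" "x \<in> {1..p}" by (auto simp: I_def)
    then show "j \<in> {..<n}" using permutes_in_image[OF w, of x] p by auto
  qed
  have b: "b \<le> n" using assms by simp
  have Suc_image: "Suc ` ({..<b} - {j. Suc j \<in> A}) = {1..b} - A" for A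
  proof (rule Set.set_eqI)
    show "x \<in> Suc ` ({..<b} - {j. Suc j \<in> A}) \<longleftrightarrow> x \<in> {1..b} - A" for x
      by (cases x) auto
  qed
  have SucJ: "Suc ` ({..<b} - J) = insert b S" and SucI: "Suc ` ({..<b} - I) = insert a S"
    unfolding J_def I_def Suc_image S by (rule refl)+
  have card: "card ({..<b} - J) = card ({..<b} - I)"
    using S arg_cong[OF SucJ, of card] arg_cong[OF SucI, of card] by (simp add: card_image)
  have prod_shift: "(\<Prod>i \<in> {..<b} - K. d (Suc i)) = prod d (Suc ` ({..<b} - K))"
    for K and d :: "nat \<Rightarrow> 'k alg_closure"
    by (simp add: prod.reindex)

  \<comment> \<open>This is the determinant identity on the quotient with denominators cleared: the
    eigenvalues are those for the cell of \<open>w\<close>, while the minors are adapted to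
    \<open>w'\<close>.\<close>
  define f :: "'k alg_closure mat \<times> 'k alg_closure mat \<Rightarrow> 'k alg_closure" where
    "f = (\<lambda>x. det (chart_mat n J \<tau> ({..<b} - J) x)
      - (\<Prod>i \<in> {..<b} - I. snd x $$ (i, i)) * det (chart_mat n J \<tau> {} x))"
  have f_poly: "f \<in> poly_functions n"
    unfolding f_def
  proof (intro poly_functions_diff poly_functions.mult poly_functions_prod poly_functions_det_chart_mat)
    show "\<tau> j < n" if "j \<in> J" for j using \<tau>p[OF that] p by simp
    show "\<tau> j < n" if "j \<in> J" for j using \<tau>p[OF that] p by simp
    fix i assume "i \<in> {..<b} - I"
    then show "(\<lambda>x. snd x $$ (i, i)) \<in> poly_functions n"
      using poly_functions.entry_snd[of i n i] b by (simp add: case_prod_unfold)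
  qed simp
  have f_inv: "f (g, \<psi>) \<noteq> 0"
    if "g \<in> carrier (GL n)" "\<beta> \<in> borel_subgroup n" "f (g * \<beta>, \<psi>) \<noteq> 0" for g \<beta> \<psi>
  proof -
    define K where "K = mat n n (\<lambda>(i, j).
      if i \<in> J \<and> j \<in> J then \<beta> $$ (\<tau> i, \<tau> j) else if i = j then 1 else 0)"
    have "g \<in> carrier_mat n n" "\<beta> \<in> carrier_mat n n" "upper_triangular \<beta>"
      using that by (simp_all add: borel_subgroup_def carrier_GL_mat)
    then have "chart_mat n J \<tau> T (g * \<beta>, \<psi>) = chart_mat n J \<tau> T (g, \<psi>) * K" for T
      unfolding K_def using J p \<tau> by (rule chart_mat_mult_right)
    moreover have "K \<in> carrier_mat n n" by (simp add: K_def)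
    ultimately have "f (g * \<beta>, \<psi>) = f (g, \<psi>) * det K"
      by (simp add: f_def det_mult[of _ n] algebra_simps)
    then show ?thesis using that(3) by auto
  qed
  have f_van: "f (\<beta> * perm_mat n w, \<psi>) = 0"
    if \<beta>: "\<beta> \<in> borel_subgroup n" and \<psi>: "\<psi> \<in> lie_b n" and U: "U \<in> lie_b n"
      and eq: "\<psi> * (\<beta> * perm_mat n w) = \<beta> * perm_mat n w * U" for \<beta> \<psi> U
  proof -
    have \<beta>GL: "\<beta> \<in> carrier (GL n)" and \<beta>c: "\<beta> \<in> carrier_mat n n" "upper_triangular \<beta>"
      using \<beta> by (simp_all add: borel_subgroup_def carrier_GL_mat)
    define \<gamma> where "\<gamma> = inv\<^bsub>GL n\<^esub> \<beta>"
    have \<gamma>: "\<gamma> \<in> carrier_mat n n" "\<beta> * \<gamma> = 1\<^sub>m n" "\<gamma> * \<beta> = 1\<^sub>m n"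
      using GL_inv[OF \<beta>GL] by (simp_all add: \<gamma>_def carrier_GL_mat)
    have \<psi>c: "\<psi> \<in> carrier_mat n n" "upper_triangular \<psi>"
      and Uc: "U \<in> carrier_mat n n" "upper_triangular U"
      using \<psi> U by (simp_all add: lie_b_def)
    define P :: "'k alg_closure mat" where "P = perm_mat n w"
    have P: "P \<in> carrier_mat n n" by (simp add: P_def)
    \<comment> \<open>Conjugated by \<open>P\<close>, the matrix
      \<open>\<gamma> * \<psi> * \<beta>\<close> becomes the upper triangular \<open>U\<close>;
      hence it preserves the span of the first \<open>p\<close> columns of \<open>P\<close>, the
      unit vectors with index in \<open>I\<close>.\<close>
    have conj: "\<gamma> * \<psi> * \<beta> * P = P * U"
    proof -
      have \<psi>\<beta>: "\<psi> * \<beta> \<in> carrier_mat n n" and \<beta>P: "\<beta> * P \<in> carrier_mat n n" and PU: "P * U \<in> carrier_mat n n"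
        using \<psi>c(1) \<beta>c(1) P Uc(1) by simp_all
      have "\<gamma> * \<psi> * \<beta> * P = \<gamma> * (\<psi> * \<beta> * P)"
        unfolding assoc_mult_mat[OF \<gamma>(1) \<psi>c(1) \<beta>c(1)] by (rule assoc_mult_mat[OF \<gamma>(1) \<psi>\<beta> P])
      also have "\<dots> = \<gamma> * (\<beta> * (P * U))"
        unfolding assoc_mult_mat[OF \<psi>c(1) \<beta>c(1) P]
        using eq assoc_mult_mat[OF \<beta>c(1) P Uc(1)] by (simp add: P_def)
      also have "\<dots> = P * U"
        using assoc_mult_mat[OF \<gamma>(1) \<beta>c(1) PU] \<gamma>(3) left_mult_one_mat[OF PU] by simp
      finally show ?thesis .
    qed
    have "det (chart_mat n J \<tau> ({..<b} - J) (\<beta> * perm_mat n w, \<psi>))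
      = (\<Prod>i \<in> {..<b} - I. \<psi> $$ (i, i)) * det (chart_mat n J \<tau> {} (\<beta> * perm_mat n w, \<psi>))"
    proof (rule det_chart_mat_eq[OF _ \<psi>c \<beta>c \<gamma>(1,2) refl I J \<rho> _ _ b card])
      show "\<beta> * perm_mat n w \<in> carrier_mat n n" using \<beta>c(1) by simp
      show "(\<beta> * perm_mat n w) $$ (i, \<tau> j) = \<beta> $$ (i, \<rho> j)" if "i < n" "j \<in> J" for i j
        using mult_perm_mat[OF \<beta>c(1) w \<open>i < n\<close>, of "\<tau> j"] \<tau>p[OF \<open>j \<in> J\<close>] p by (simp add: \<rho>_def)
      \<comment> \<open>The entry equals one of \<open>U\<close> in a column \<open>l < p\<close>
        and in a row that is at least \<open>p\<close>, since \<open>i \<notin> I\<close>; this is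
        below the diagonal.\<close>
      show "(\<gamma> * \<psi> * \<beta>) $$ (i, k) = 0" if i: "i < n" "i \<notin> I" and k: "k \<in> I" for i k
      proof -
        have "k \<in> (\<lambda>l. w (Suc l) - 1) ` {..<p}"
          using bij_betw_imp_surj_on[OF bij_betw_perm_shift(1)[OF w p]] k by (simp add: I_def)
        then obtain l where l: "k = w (Suc l) - 1" "l < p" by blast
        have "?w (Suc i) \<in> {1..n}"
          using permutes_in_image[OF permutes_inv[OF w], of "Suc i"] i by simp
        moreover have "?w (Suc i) \<notin> {1..p}"
        proof
          assume "?w (Suc i) \<in> {1..p}"
          then have "w (?w (Suc i)) \<in> w ` {1..p}" by blast
          then show False using i(2) permutes_inverses(1)[OF w] by (simp add: I_def)
        qed
        ultimately have c: "?w (Suc i) - 1 < n" "p \<le> ?w (Suc i) - 1" by auto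
        have "\<gamma> * \<psi> * \<beta> \<in> carrier_mat n n" using \<gamma>(1) \<psi>c(1) \<beta>c(1) by simp
        then have "(\<gamma> * \<psi> * \<beta>) $$ (i, k) = (\<gamma> * \<psi> * \<beta> * P) $$ (i, l)"
          using mult_perm_mat[of "\<gamma> * \<psi> * \<beta>" n w i l] w i l p by (simp add: P_def)
        also have "\<dots> = U $$ (?w (Suc i) - 1, l)"
          unfolding conj unfolding P_def using perm_mat_mult[OF Uc(1) w i(1), of l] l p by simp
        also have "\<dots> = 0"
          using upper_triangularD[OF Uc(2), of l "?w (Suc i) - 1"] c l Uc(1) by simp
        finally show ?thesis .
      qed
    qed
    then show ?thesis by (simp add: f_def)
  qed

  \<comment> \<open>The values 2 and 1 are distinct, and nonzero in characteristic 0. Being constant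
    on the orbits of \<open>\<sigma>\<close>, \<open>d\<close> gives a diagonal matrix fixed by
    \<open>\<sigma>\<close>, and by (iv) it separates \<open>a\<close> from
    \<open>b\<close>.\<close>
  define d :: "nat \<Rightarrow> 'k alg_closure" where "d = (\<lambda>i. if a \<in> orbit \<sigma> i then 2 else 1)"
  have perm\<sigma>: "permutation \<sigma>" using \<sigma> by (auto simp: permutation_permutes)
  have d\<sigma>: "d (\<sigma> i) = d i" for i
    by (simp add: d_def permutation_orbit_step[OF perm\<sigma>])
  have "a \<notin> orbit \<sigma> b"
    using assms(14) orbit_swap[OF permutation_self_in_orbit[OF perm\<sigma>, of b], of a]
    by (auto simp: \<sigma>_def)
  then have dab: "d a \<noteq> d b" "d i \<noteq> 0" for i
    using permutation_self_in_orbit[OF perm\<sigma>, of a] by (auto simp: d_def)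
  define \<Delta> :: "(nat \<Rightarrow> 'k alg_closure) \<Rightarrow> 'k alg_closure mat" where
    "\<Delta> = (\<lambda>d. mat n n (\<lambda>(i, j). if i = j then d (Suc i) else 0))"
  have \<Delta>_carrier: "\<Delta> e \<in> carrier_mat n n" for e by (simp add: \<Delta>_def)
  have \<Delta>_b: "\<Delta> e \<in> lie_b n" for e
    by (auto simp: \<Delta>_def lie_b_def)
  have perm_\<Delta>: "perm_mat n v * \<Delta> (e \<circ> v) = \<Delta> e * perm_mat n v" if v: "v permutes {1..n}" for v e
  proof (rule eq_matI)
    fix i j assume "i < dim_row (\<Delta> e * perm_mat n v)" "j < dim_col (\<Delta> e * perm_mat n v)"
    then have ij: "i < n" "j < n" by (simp_all add: \<Delta>_def perm_mat_def)
    have "v (Suc j) \<in> {1..n}" using permutes_in_image[OF v, of "Suc j"] ij by simp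
    then obtain c where c: "v (Suc j) = Suc c" "c < n" by (cases "v (Suc j)") auto
    have "inv_into UNIV v (Suc i) \<in> {1..n}"
      using permutes_in_image[OF permutes_inv[OF v], of "Suc i"] ij by simp
    then obtain c' where c': "inv_into UNIV v (Suc i) = Suc c'" "c' < n"
      by (cases "inv_into UNIV v (Suc i)") auto
    have "Suc i = Suc c \<longleftrightarrow> Suc c' = Suc j"
      using permutes_inv_eq[OF v, of "Suc i" "Suc j"] unfolding c c' by auto
    then show "(perm_mat n v * \<Delta> (e \<circ> v)) $$ (i, j) = (\<Delta> e * perm_mat n v) $$ (i, j)"
      using perm_mat_mult[OF \<Delta>_carrier v ij] mult_perm_mat[OF \<Delta>_carrier v ij] ij c c'
      by (auto simp: \<Delta>_def)
  qed (simp_all add: \<Delta>_def perm_mat_def)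
  let ?x = "(flag_coset n (perm_mat n w'), \<Delta> d)"
  have gw': "(perm_mat n w' :: 'k alg_closure mat) \<in> carrier (GL n)"
    by (rule perm_mat_GL[OF w'])
  have "Ad n (inv\<^bsub>GL n\<^esub> (perm_mat n w')) (\<Delta> d) = \<Delta> (d \<circ> w')"
  proof (rule Ad_eqI[OF GL_inv(1)[OF gw'] \<Delta>_carrier \<Delta>_carrier])
    let ?i = "inv\<^bsub>GL n\<^esub> (perm_mat n w') :: 'k alg_closure mat"
    let ?P = "perm_mat n w' :: 'k alg_closure mat"
    have i: "?i \<in> carrier_mat n n" by (rule carrier_GL_mat[OF GL_inv(1)[OF gw']])
    have "\<Delta> (d \<circ> w') = ?i * (?P * \<Delta> (d \<circ> w'))"
      using assoc_mult_mat[OF i perm_mat_carrier[of n w'] \<Delta>_carrier[of "d \<circ> w'"]]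
      unfolding GL_inv(2)[OF gw'] left_mult_one_mat[OF \<Delta>_carrier] .
    also have "\<dots> = ?i * (\<Delta> d * ?P)" unfolding perm_\<Delta>[OF w'] ..
    also have "\<dots> = ?i * \<Delta> d * ?P" by (rule assoc_mult_mat[OF i \<Delta>_carrier perm_mat_carrier, symmetric])
    finally have *: "\<Delta> (d \<circ> w') = ?i * \<Delta> d * ?P" .
    have iD: "?i * \<Delta> d \<in> carrier_mat n n" using i \<Delta>_carrier by (rule mult_carrier_mat)
    show "?i * \<Delta> d = \<Delta> (d \<circ> w') * ?i"
      unfolding * using assoc_mult_mat[OF iD perm_mat_carrier i] GL_inv(3)[OF gw'] right_mult_one_mat[OF iD]
      by simp
  qed
  then have X: "?x \<in> X_tilde n"
    unfolding X_tilde_def using gw' \<Delta>_b[of d] \<Delta>_b[of "d \<circ> w'"] by force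
  have "1\<^sub>m n * perm_mat n w' = (perm_mat n w' :: 'k alg_closure mat)"
    by (rule left_mult_one_mat[OF perm_mat_carrier])
  then have "flag_coset n (perm_mat n w' :: 'k alg_closure mat) \<in> schubert_cell n w'"
    unfolding schubert_cell_def using one_borel[of n] by force
  then have V: "?x \<in> V_tilde n w'" using X by (simp add: V_tilde_def)
  have "Ad n (perm_mat n \<sigma>) (\<Delta> d) = \<Delta> d"
  proof (rule Ad_eqI[OF perm_mat_GL[OF \<sigma>] \<Delta>_carrier \<Delta>_carrier])
    have "d \<circ> \<sigma> = d" using d\<sigma> by auto
    then show "perm_mat n \<sigma> * \<Delta> d = \<Delta> d * perm_mat n \<sigma>" using perm_\<Delta>[OF \<sigma>, of d] by simp
  qed
  then have "\<Delta> d \<in> lie_t_fixed n \<sigma>"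
    by (auto simp: lie_t_fixed_def lie_t_def diagonal_mat_def \<Delta>_def)
  moreover have "0\<^sub>m n n \<in> lie_u n" by (simp add: lie_u_def)
  moreover have "\<Delta> d = \<Delta> d + 0\<^sub>m n n" using right_add_zero_mat[OF \<Delta>_carrier] by simp
  ultimately have q: "?x \<in> q_preimage n {s + x | s x. s \<in> lie_t_fixed n \<sigma> \<and> x \<in> lie_u n}"
    unfolding q_preimage_def using X by auto

  have chart: "chart_mat n J \<tau> T (perm_mat n w', \<Delta> d)
      = mat n n (\<lambda>(i, j). if i = j then if i \<in> T then d (Suc i) else 1 else 0)"
    if T: "T \<inter> J = {}" for T
  proof (rule eq_matI)
    let ?D = "mat n n (\<lambda>(i, j). if i = j then if i \<in> T then d (Suc i) else 1 else 0)"
    fix i j assume "i < dim_row ?D" "j < dim_col ?D"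
    then have ij: "i < n" "j < n" by simp_all
    \<comment> \<open>At the test point the column of \<open>g\<close> placed at
      \<open>j \<in> J\<close> is the \<open>j\<close>-th unit vector, so the chart matrix is
      diagonal.\<close>
    have "perm_mat n w' $$ (i, \<tau> j) = (if i = j then 1 else 0 :: 'k alg_closure)" if "j \<in> J"
    proof -
      have "?w' (Suc j) \<in> {1..n}"
        using permutes_in_image[OF permutes_inv[OF w'], of "Suc j"] ij by simp
      then have "Suc (\<tau> j) = ?w' (Suc j)" by (simp add: \<tau>_def)
      then have "w' (Suc (\<tau> j)) = Suc j" using permutes_inverses(1)[OF w'] by simp
      then show ?thesis using \<tau>p[OF that] p ij by (simp add: perm_mat_def)
    qed
    then show "chart_mat n J \<tau> T (perm_mat n w', \<Delta> d) $$ (i, j) = ?D $$ (i, j)"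
      using ij T by (auto simp: chart_mat_def \<Delta>_def)
  qed (simp_all add: chart_mat_def)
  have "f (perm_mat n w', \<Delta> d) = prod d (insert b S) - prod d (insert a S)"
  proof -
    have "{0..<n} \<inter> ({..<b} - J) = {..<b} - J" using b by auto
    then have "det (chart_mat n J \<tau> ({..<b} - J) (perm_mat n w', \<Delta> d))
        = (\<Prod>i \<in> {..<b} - J. d (Suc i))"
      using chart[of "{..<b} - J"] prod.inter_restrict[of "{0..<n}" "\<lambda>i. d (Suc i)" "{..<b} - J"]
      by (simp add: det_diagonal_mat Diff_Int_distrib2)
    moreover have "det (chart_mat n J \<tau> {} (perm_mat n w', \<Delta> d)) = 1"
      using chart[of "{}"] by (simp add: det_diagonal_mat)
    moreover have "(\<Prod>i \<in> {..<b} - I. \<Delta> d $$ (i, i)) = (\<Prod>i \<in> {..<b} - I. d (Suc i))"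
      by (rule prod.cong[OF refl]) (use b in \<open>auto simp: \<Delta>_def\<close>)
    ultimately show ?thesis
      unfolding f_def snd_conv by (simp only: prod_shift SucJ SucI mult_1_right)
  qed
  \<comment> \<open>The common set \<open>S\<close> contributes a nonzero factor, which leaves the
    difference of the values at \<open>b\<close> and \<open>a\<close>.\<close>
  also have "\<dots> = (d b - d a) * prod d S"
    using S by (simp add: algebra_simps)
  finally have nz: "f (perm_mat n w', \<Delta> d) \<noteq> 0" using dab S(5) by simp
  have "?x \<notin> X_tilde_w n w"
    by (rule not_in_X_tilde_w[OF f_poly _ w _ gw' \<Delta>_b nz]) (fact f_inv, fact f_van)
  then show ?thesis using V q unfolding \<sigma>_def by blast
qed

end
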